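(* Let $G=(V,E)$ be a finite connected planar graph embedded in the plane, let $(J_e)_{e\in E}$ be arbitrary real coupling constants and let $U_e=0$ for all $e\in E$. Let $A_1,A_2,B_1,B_2$ be pairwise disjoint sets of vertices lying on the outer face of $G$, with associated ordered set of nodes $\mathcal N$, coloring $\mathcal B$, sources $\mathcal S_+$ and sinks $\mathcal S_-$. Then $$\langle\varphi_{A_1}\varphi^2_{A_2}\tilde\varphi_{B_1}\tilde\varphi^2_{B_2}\rangle=\begin{cases}2^{-|\mathcal N|/2}\det(K^{\mathcal S_+,\mathcal S_-})&\text{if }|\mathcal S_+|=|\mathcal S_-|,\\0&\text{otherwise,}\end{cases}$$ where $K^{\mathcal S_+,\mathcal S_-}$ is the $\mathcal S_+\times\mathcal S_-$ matrix with entries $K^{\mathcal S_+,\mathcal S_-}_{u,v}=(-1)^{s(u,v)}\langle\sigma_u\sigma_v\rangle$, and $s(u,v)$ is the number of sources strictly between $u$ and $v$ in the order on $\mathcal N$. In particular, when $|\mathcal S_+|=|\mathcal S_-|$, the determinant $\det(K^{\mathcal S_+,\mathcal S_-})$ is nonnegative if the coupling constants satisfy $J_e\ge0$ and $\cosh(2J_e)\ge e^{-2U_e}$ for all $e\in E$.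
   Context: The Ashkin--Teller model (free boundary conditions) on a finite graph $G=(V,E)$ with real coupling constants $J_e,U_e$ is the probability measure on pairs $(\sigma,\tilde\sigma)\in\{-1,1\}^V\times\{-1,1\}^V$ given by $$\mathbf P(\sigma,\tilde\sigma)=\frac1{\mathcal Z}\prod_{uv\in E}\exp\big(J_{uv}(\sigma_u\sigma_v+\tilde\sigma_u\tilde\sigma_v)+U_{uv}(\sigma_u\sigma_v\tilde\sigma_u\tilde\sigma_v+1)\big),$$ with $\mathcal Z$ the normalizing constant; $\langle\cdot\rangle$ is the expectation. (For $U=0$ these are two independent Ising models.) Define $\varphi_v=(\sigma_v+\tilde\sigma_v)/2$ and $\tilde\varphi_v=(\sigma_v-\tilde\sigma_v)/2$. For a set $A$, $\varphi_A=\prod_{v\in A}\varphi_v$, $\varphi_A^2=\prod_{v\in A}\varphi_v^2$, and similarly for $\tilde\varphi$ (empty products equal $1$). Nodes and colorings: the vertices in $A_2\cup B_2$ are called doubled. The set of nodes $\mathcal N$ consists of the vertices of $A_1\cup B_1$ together with two copies $v^<,v^>$ of each doubled vertex $v$. It is assumed that $|\mathcal N|=2n$ is even. The nodes are ordered as $v_1<\dots<v_{2n}$ counterclockwise along the boundary of the outer face (starting anywhere; if a vertex is visited several times by the boundary walk, one of its visits is fixed), with $v^>$ coming immediately after $v^<$. In correlations, nodes are projected onto the underlying vertices ($\sigma_{v^<}=\sigma_{v^>}=\sigma_v$, so $\langle\sigma_{v^<}\sigma_{v^>}\rangle=1$). Nodes coming from $A_1\cup A_2$ are red (set $\mathcal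 R$), those coming from $B_1\cup B_2$ are blue (set $\mathcal B$). With $\mathcal N_e,\mathcal N_o$ the nodes of even and odd index, the sources and sinks are $$\mathcal S_+=(\mathcal N_o\cap\mathcal B)\cup(\mathcal N_e\cap\mathcal R),\qquad \mathcal S_-=(\mathcal N_e\cap\mathcal B)\cup(\mathcal N_o\cap\mathcal R).$$ Rows and columns of $K^{\mathcal S_+,\mathcal S_-}$ are arranged in the order inherited from $\mathcal N$. *)

theory Defs
  imports
    "HOL-Complex_Analysis.Winding_Numbers"
    "Jordan_Normal_Form.Determinant"
begin

section \<open>Finite connected plane graphs\<close>

definition finite_simple_graph :: "'a set \<Rightarrow> 'a set set \<Rightarrow> bool" where
  "finite_simple_graph V E \<longleftrightarrow> finite V \<and> (\<forall>e\<in>E. e \<subseteq> V \<and> card e = 2)"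

definition connected_graph :: "'a set \<Rightarrow> 'a set set \<Rightarrow> bool" where
  "connected_graph V E \<longleftrightarrow> V \<noteq> {} \<and> (\<forall>u\<in>V. \<forall>v\<in>V. (u, v) \<in> {(x, y). {x, y} \<in> E}\<^sup>*)"

text \<open>Vertices are drawn as distinct points, an edge as an arc joining its two end points.
  An arc meets the vertices and the other arcs only in common end points.\<close>

definition plane_embedding ::
    "'a set \<Rightarrow> 'a set set \<Rightarrow> ('a \<Rightarrow> complex) \<Rightarrow> ('a set \<Rightarrow> real \<Rightarrow> complex) \<Rightarrow> bool" where
  "plane_embedding V E pos \<gamma> \<longleftrightarrow>
     inj_on pos V \<and>
     (\<forall>e\<in>E. arc (\<gamma> e) \<and> {pathstart (\<gamma> e), pathfinish (\<gamma> e)} = pos ` e \<and>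
            path_image (\<gamma> e) \<inter> pos ` V = pos ` e) \<and>
     (\<forall>e\<in>E. \<forall>e'\<in>E. e \<noteq> e' \<longrightarrow> path_image (\<gamma> e) \<inter> path_image (\<gamma> e') = pos ` (e \<inter> e'))"

definition drawing ::
    "'a set \<Rightarrow> 'a set set \<Rightarrow> ('a \<Rightarrow> complex) \<Rightarrow> ('a set \<Rightarrow> real \<Rightarrow> complex) \<Rightarrow> complex set" where
  "drawing V E pos \<gamma> = pos ` V \<union> (\<Union>e\<in>E. path_image (\<gamma> e))"

text \<open>The outer face of a drawing \<open>X\<close> is \<^term>\<open>outside X\<close>, the unbounded component of the
  complement.\<close>

definition on_outer_face :: "complex set \<Rightarrow> complex \<Rightarrow> bool" where
  "on_outer_face X p \<longleftrightarrow> p \<in> X \<and> p \<in> frontier (outside X)"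

text \<open>The closed walk along the boundary of the outer face is rendered as a loop
  \<open>\<theta> \<mapsto> F (cis \<theta>)\<close>. Here \<open>F\<close> identifies the exterior of the closed unit disc with the outer
  face and extends continuously to the unit circle, which it wraps around the boundary of the
  face. For every finite connected plane graph such an \<open>F\<close> exists by Caratheodory's theorem
  (if \<open>X\<close> is a single point \<open>p\<close>, take \<open>F z = p + (norm z - 1) * sgn z\<close>).
  A vertex that is visited several times by the walk has one parameter on the circle
  for each visit. The winding number condition says that \<open>F\<close> preserves the orientation,
  so that increasing \<open>\<theta>\<close> follows the boundary counterclockwise around the graph.\<close>

definition ccw_outer_boundary :: "complex set \<Rightarrow> (complex \<Rightarrow> complex) \<Rightarrow> bool" where
  "ccw_outer_boundary X F \<longleftrightarrow>
     continuous_on (- ball 0 1) F \<and>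
     (\<exists>G. homeomorphism (- cball 0 1) (outside X) F G) \<and>
     (\<forall>r>1. \<forall>w\<in>X. winding_number (F \<circ> circlepath 0 r) w = 1)"

text \<open>The points \<open>ps\<close> are met in this order during one turn along the boundary of the outer
  face that starts at the parameter \<open>t\<^sub>0\<close>. The list \<open>ts\<close> fixes one visit for each point.\<close>

definition ccw_outer_order :: "complex set \<Rightarrow> complex list \<Rightarrow> bool" where
  "ccw_outer_order X ps \<longleftrightarrow>
     (\<exists>F t\<^sub>0 ts. ccw_outer_boundary X F \<and> sorted_wrt (<) ts \<and> set ts \<subseteq> {t\<^sub>0..<t\<^sub>0 + 2 * pi} \<and>
        ps = map (\<lambda>t. F (cis t)) ts)"

section \<open>The Ashkin--Teller model\<close>

definition spin_configs :: "'a set \<Rightarrow> ('a \<Rightarrow> real) set" where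
  "spin_configs V = V \<rightarrow>\<^sub>E {-1, 1}"

text \<open>For an edge \<open>e = {u, v}\<close> the product \<open>\<Prod>x\<in>e. \<sigma> x\<close> is \<open>\<sigma> u * \<sigma> v\<close>.\<close>

definition AT_weight ::
    "'a set set \<Rightarrow> ('a set \<Rightarrow> real) \<Rightarrow> ('a set \<Rightarrow> real) \<Rightarrow> ('a \<Rightarrow> real) \<Rightarrow> ('a \<Rightarrow> real) \<Rightarrow> real" where
  "AT_weight E J U \<sigma> \<tau> =
     (\<Prod>e\<in>E. exp (J e * ((\<Prod>x\<in>e. \<sigma> x) + (\<Prod>x\<in>e. \<tau> x)) +
                  U e * ((\<Prod>x\<in>e. \<sigma> x) * (\<Prod>x\<in>e. \<tau> x) + 1)))"

definition AT_partition ::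
    "'a set \<Rightarrow> 'a set set \<Rightarrow> ('a set \<Rightarrow> real) \<Rightarrow> ('a set \<Rightarrow> real) \<Rightarrow> real" where
  "AT_partition V E J U = (\<Sum>\<sigma>\<in>spin_configs V. \<Sum>\<tau>\<in>spin_configs V. AT_weight E J U \<sigma> \<tau>)"

definition AT_prob ::
    "'a set \<Rightarrow> 'a set set \<Rightarrow> ('a set \<Rightarrow> real) \<Rightarrow> ('a set \<Rightarrow> real) \<Rightarrow>
     ('a \<Rightarrow> real) \<Rightarrow> ('a \<Rightarrow> real) \<Rightarrow> real" where
  "AT_prob V E J U \<sigma> \<tau> = AT_weight E J U \<sigma> \<tau> / AT_partition V E J U"

definition AT_expect ::
    "'a set \<Rightarrow> 'a set set \<Rightarrow> ('a set \<Rightarrow> real) \<Rightarrow> ('a set \<Rightarrow> real) \<Rightarrow>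
     (('a \<Rightarrow> real) \<Rightarrow> ('a \<Rightarrow> real) \<Rightarrow> real) \<Rightarrow> real" where
  "AT_expect V E J U f =
     (\<Sum>\<sigma>\<in>spin_configs V. \<Sum>\<tau>\<in>spin_configs V. AT_prob V E J U \<sigma> \<tau> * f \<sigma> \<tau>)"

definition phi :: "('a \<Rightarrow> real) \<Rightarrow> ('a \<Rightarrow> real) \<Rightarrow> 'a \<Rightarrow> real" where
  "phi \<sigma> \<tau> v = (\<sigma> v + \<tau> v) / 2"

definition phi_tilde :: "('a \<Rightarrow> real) \<Rightarrow> ('a \<Rightarrow> real) \<Rightarrow> 'a \<Rightarrow> real" where
  "phi_tilde \<sigma> \<tau> v = (\<sigma> v - \<tau> v) / 2"

section \<open>Nodes, sources and sinks\<close>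

text \<open>\<open>Lower v\<close> and \<open>Upper v\<close> are the two copies $v^<$ and $v^>$ of a doubled vertex.\<close>

datatype 'a node = Single (vertex: 'a) | Lower (vertex: 'a) | Upper (vertex: 'a)

definition node_set :: "'a set \<Rightarrow> 'a set \<Rightarrow> 'a node set" where
  "node_set S D = Single ` S \<union> Lower ` D \<union> Upper ` D"

text \<open>From an ordered list of vertices to the ordered list of nodes; \<open>D\<close> is the set of doubled
  vertices.\<close>

definition node_list :: "'a set \<Rightarrow> 'a list \<Rightarrow> 'a node list" where
  "node_list D ws = concat (map (\<lambda>v. if v \<in> D then [Lower v, Upper v] else [Single v]) ws)"

lemma set_node_list:
  assumes "set ws = S \<union> D" "S \<inter> D = {}"
  shows "set (node_list D ws) = node_set S D"
  using assms unfolding node_list_def node_set_def by (auto split: if_splits)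

lemma distinct_node_list: "distinct ws \<Longrightarrow> distinct (node_list D ws)"
  by (induction ws) (auto simp: node_list_def split: if_splits)

text \<open>Nodes are numbered from 1, and subsets of the nodes are given by their indices.\<close>

definition nth_node :: "'a node list \<Rightarrow> nat \<Rightarrow> 'a node" where
  "nth_node ns k = ns ! (k - 1)"

definition sources :: "'a node set \<Rightarrow> 'a node set \<Rightarrow> 'a node list \<Rightarrow> nat set" where
  "sources R B ns =
     {k \<in> {1..length ns}. (odd k \<and> nth_node ns k \<in> B) \<or> (even k \<and> nth_node ns k \<in> R)}"

definition sinks :: "'a node set \<Rightarrow> 'a node set \<Rightarrow> 'a node list \<Rightarrow> nat set" where
  "sinks R B ns =
     {k \<in> {1..length ns}. (even k \<and> nth_node ns k \<in> B) \<or> (odd k \<and> nth_node ns k \<in> R)}"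

definition sources_between :: "nat set \<Rightarrow> nat \<Rightarrow> nat \<Rightarrow> nat" where
  "sources_between P k l = card {m \<in> P. min k l < m \<and> m < max k l}"

text \<open>Row \<open>i\<close> belongs to the \<open>i\<close>-th smallest source index in \<open>P\<close>, column \<open>j\<close> to the \<open>j\<close>-th
  smallest sink index in \<open>M\<close>; \<open>c u v\<close> is the two-point function of vertices.\<close>

definition K_matrix ::
    "('a \<Rightarrow> 'a \<Rightarrow> real) \<Rightarrow> 'a node list \<Rightarrow> nat set \<Rightarrow> nat set \<Rightarrow> real mat" where
  "K_matrix c ns P M =
     Matrix.mat (card P) (card M) (\<lambda>(i, j).
       let k = sorted_list_of_set P ! i; l = sorted_list_of_set M ! j
       in (-1) ^ sources_between P k l * c (vertex (nth_node ns k)) (vertex (nth_node ns l)))"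

end

theory Submission
  imports Defs
begin

text \<open>For \<open>U = 0\<close> the measure is a product of two Ising measures. Put \<open>\<rho> = \<sigma>\<tau>\<close>. Given \<open>\<rho>\<close>, the
  spins \<open>\<tau>\<close> form an Ising model on the edges along which \<open>\<rho>\<close> is constant, so the correlation of
  \<open>\<tau>\<close> over a set \<open>T\<close> of nodes vanishes unless every cluster of these edges contains an even number
  of nodes of \<open>T\<close>. By planarity the clusters do not cross on the boundary of the outer face, hence
  in the nonvanishing case the nodes of each cluster alternate in parity and
  \<open>\<Sum>\<^sub>j (-1)\<^sup>j \<rho>\<^sub>j = 0\<close>. Multiplied by \<open>\<rho>\<^sub>m\<close> for the first node \<open>m\<close>, this is the recursion of
  a Pfaffian for the boundary spin correlations. Expanding \<open>\<sigma> \<plusminus> \<tau>\<close> over the nodes gives a signed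
  sum of products of two such Pfaffians, which is the Pfaffian of a matrix that only couples sources
  with sinks, that is, a determinant. The alternating signs in the definition of sources and sinks
  are exactly those of this expansion.

  Planarity enters through one fact: if \<open>t\<^sub>1 < t\<^sub>2 < t\<^sub>3 < t\<^sub>4\<close> within one turn of the boundary,
  connected subsets of the drawing that join the first with the third and the second with the fourth
  point meet. Otherwise, close up the first path through the outer face; the resulting loop would
  have different winding numbers around the second and the fourth point.

  The determinant is nonnegative by Ginibre's inequality for \<open>\<phi>\<close> and \<open>\<phi>'\<close>.\<close>

section \<open>Paths crossing in the closed outer domain\<close>

text \<open>A large circle around \<open>X\<close> lies in the outer face, and its image under
  \<open>G\<close> is compact. Beyond that image \<open>F\<close> avoids the circle, so by
  connectedness it stays on one side of it. The inner side is impossible, because the rest of the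
  outer face is the image of a compact annulus and the outer face would be bounded.\<close>

lemma outer_map_escapes:
  fixes X :: "complex set" and F :: "complex \<Rightarrow> complex"
  assumes X: "compact X"
    and cont: "continuous_on (- ball 0 1) F"
    and hom: "homeomorphism (- cball 0 1) (outside X) F G"
  shows "\<exists>R. \<forall>z. norm z > R \<longrightarrow> norm (F z) > M"
proof -
  obtain M0 where M0: "M0 > 0" "X \<subseteq> ball 0 M0"
    using bounded_subset_ballD compact_imp_bounded[OF X] by blast
  define M1 where "M1 = max M M0"
  have X1: "X \<subseteq> ball 0 M1" and M1: "M1 > 0" "M \<le> M1"
    using M0 by (auto simp: M1_def)
  have sph: "sphere 0 M1 \<subseteq> outside X"
  proof -
    have "- ball 0 M1 \<subseteq> outside X"
      using convex_in_outside[OF convex_ball[of 0 M1]] outside_mono[OF X1] by blast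
    then show ?thesis by auto
  qed
  have "compact (G ` sphere 0 M1)"
    using continuous_on_subset[OF homeomorphism_cont2[OF hom] sph] by (simp add: compact_continuous_image)
  from bounded_subset_ballD[OF compact_imp_bounded[OF this], of 0]
  obtain R0 where R0: "R0 > 0" "G ` sphere 0 M1 \<subseteq> ball 0 R0" by auto
  define R where "R = max R0 2"
  have R: "R \<ge> 2" and GR: "G ` sphere 0 M1 \<subseteq> ball 0 R"
    using R0 by (auto simp: R_def)
  have con: "connected (F ` (- cball 0 R))"
  proof (rule connected_continuous_image)
    show "continuous_on (- cball 0 R) F"
      using cont by (rule continuous_on_subset) (use R in auto)
    show "connected (- cball 0 R :: complex set)"
      by (intro connected_complement_bounded_convex) auto
  qed
  have avoid: "norm (F z) \<noteq> M1" if "norm z > R" for z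
  proof
    assume "norm (F z) = M1"
    then have "F z \<in> sphere 0 M1" by simp
    then have "G (F z) \<in> ball 0 R" using GR by blast
    moreover have "G (F z) = z" using hom that R by (auto simp: homeomorphism_def)
    ultimately show False using that by simp
  qed
  have "F ` (- cball 0 R) \<inter> ball 0 M1 = {}"
  proof (rule ccontr)
    assume ne: "F ` (- cball 0 R) \<inter> ball 0 M1 \<noteq> {}"
    have "F ` (- cball 0 R) \<subseteq> ball 0 M1"
    proof (rule ccontr)
      assume "\<not> F ` (- cball 0 R) \<subseteq> ball 0 M1"
      then have "F ` (- cball 0 R) \<inter> frontier (ball 0 M1) \<noteq> {}"
        using connected_Int_frontier[OF con ne] by auto
      then show False using avoid M1 by (auto simp: frontier_ball)
    qed
    moreover have "bounded (F ` (cball 0 R - ball 0 1))"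
    proof (intro compact_imp_bounded compact_continuous_image)
      show "continuous_on (cball 0 R - ball 0 1) F" using cont by (rule continuous_on_subset) auto
      show "compact (cball 0 R - ball 0 1 :: complex set)" by (simp add: compact_diff)
    qed
    ultimately have "bounded (F ` (cball 0 R - ball 0 1) \<union> F ` (- cball 0 R))"
      using bounded_subset[OF bounded_ball] by auto
    moreover have "outside X = F ` (- cball 0 1)" using hom by (auto simp: homeomorphism_def)
    then have "outside X \<subseteq> F ` (cball 0 R - ball 0 1) \<union> F ` (- cball 0 R)" by auto
    ultimately have "bounded (outside X)" using bounded_subset by blast
    then show False using unbounded_outside[OF compact_imp_bounded[OF X]] by blast
  qed
  then have "\<not> norm (F z) < M1" if "norm z > R" for z
    using that by (auto simp: disjoint_iff)
  then have "norm (F z) > M" if "norm z > R" for z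
    using avoid[OF that] that M1 by fastforce
  then show ?thesis by blast
qed

text \<open>The two angles differ by a multiple of a full turn and by less than one turn. One
  parameter is kept strictly inside the turn, since \<open>0\<close> and \<open>1\<close> give the
  same point of the circle.\<close>

lemma cis_turn_eq:
  assumes "cis (t + 2 * pi * s) = cis (t + 2 * pi * s')" "0 < s" "s < 1" "0 \<le> s'" "s' \<le> 1"
  shows "s = s'"
proof -
  obtain n :: int where "t + 2 * pi * s = t + 2 * pi * s' + 2 * pi * n"
    using assms(1) sin_cos_eq_iff[of "t + 2 * pi * s" "t + 2 * pi * s'"] by (auto simp: complex_eq_iff)
  then have "2 * pi * (s - s' - n) = 0" by (simp add: algebra_simps)
  then have "s - s' = n" by simp
  moreover have "-1 < s - s'" "s - s' < 1" using assms by auto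
  ultimately have "n = 0" by linarith
  then show ?thesis using \<open>s - s' = n\<close> by simp
qed

text \<open>The orientation condition of \<open>ccw_outer_boundary\<close> concerns circles that
  start at angle 0. Moving the starting point of a loop does not change its winding number.\<close>

lemma winding_number_outer_circle:
  assumes cb: "ccw_outer_boundary X F" and w: "w \<in> X" and r: "r > 1"
  shows "winding_number (\<lambda>s. F (of_real r * cis (t + 2 * pi * s))) w = 1"
proof -
  define f where "f = F \<circ> circlepath 0 r"
  \<comment> \<open>The starting point is moved by the fraction \<open>a\<close> of a turn; only the
    fractional part counts, and it lies in the range that \<open>shiftpath\<close> requires.\<close>
  define a where "a = frac (t / (2 * pi))"
  obtain G where cont: "continuous_on (- ball 0 1) F"
    and hom: "homeomorphism (- cball 0 1) (outside X) F G"
    using cb by (auto simp: ccw_outer_boundary_def)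
  have circ: "circlepath 0 r x = of_real r * cis (2 * pi * x)" for x
    by (simp add: circlepath cis_conv_exp algebra_simps)
  have pf: "path f"
    unfolding f_def path_def
  proof (rule continuous_on_compose)
    show "continuous_on (circlepath 0 r ` {0..1}) F"
      using cont by (rule continuous_on_subset) (use r in \<open>auto simp: circ norm_mult\<close>)
  qed (use path_circlepath in \<open>simp add: path_def\<close>)
  have wf: "w \<notin> path_image f"
  proof
    assume "w \<in> path_image f"
    then obtain x where "w = F (of_real r * cis (2 * pi * x))"
      by (auto simp: path_image_def f_def circ)
    moreover have "F (of_real r * cis (2 * pi * x)) \<in> outside X"
      using hom r by (auto simp: homeomorphism_def norm_mult)
    ultimately show False using w outside_no_overlap by blast
  qed
  have a01: "a \<in> {0..1}" by (simp add: a_def frac_ge_0 frac_lt_1 less_imp_le)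
  have eq: "shiftpath a f = (\<lambda>s. F (of_real r * cis (t + 2 * pi * s)))"
  proof
    fix s
    define k where "k = \<lfloor>t / (2 * pi)\<rfloor>"
    have t: "t = 2 * pi * (a + k)"
      by (simp add: a_def k_def frac_def)
    have per: "cis (2 * pi * (a + s)) = cis (t + 2 * pi * s)"
    proof -
      have "t + 2 * pi * s = 2 * pi * (a + s) + 2 * pi * k" by (simp add: t algebra_simps)
      then show ?thesis by (metis (no_types) cis_mult cis_multiple_2pi Ints_of_int mult.right_neutral mult.commute)
    qed
    have "cis (2 * pi * (a + s - 1)) = cis (2 * pi * (a + s))"
      by (simp add: right_diff_distrib flip: cis_divide)
    then show "shiftpath a f s = F (of_real r * cis (t + 2 * pi * s))"
      by (simp add: shiftpath_def f_def circ per)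
  qed
  have "pathfinish f = pathstart f" by (simp add: f_def pathfinish_def pathstart_def circ)
  then have "winding_number (shiftpath a f) w = winding_number f w"
    using winding_number_shiftpath pf wf a01 by blast
  also have "\<dots> = 1" using cb r w by (auto simp: ccw_outer_boundary_def f_def)
  finally show ?thesis by (simp add: eq)
qed

text \<open>If \<open>p\<close> misses \<open>Q\<close>, close up \<open>p\<close> through the outer
  face in two ways, around either side of a circle in it. One loop can be avoided on the way from
  the fourth point to infinity, the other from the second point, so these two winding numbers
  vanish. Since \<open>Q\<close> is connected and misses the first loop, its winding number also
  vanishes at the second point. But the two loops differ by a full circle, which has winding number
  1 there.\<close>

lemma ccw_outer_boundary_crossing:
  assumes X: "compact X" and cb: "ccw_outer_boundary X F"
    and p: "path p" "path_image p \<subseteq> X" "pathstart p = F (cis t1)" "pathfinish p = F (cis t3)"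
    and Q: "connected Q" "Q \<subseteq> X" "F (cis t2) \<in> Q" "F (cis t4) \<in> Q"
    and t: "t1 < t2" "t2 < t3" "t3 < t4" "t4 < t1 + 2 * pi"
  shows "path_image p \<inter> Q \<noteq> {}"
proof
  assume disj: "path_image p \<inter> Q = {}"
  obtain G where cont: "continuous_on (- ball 0 1) F"
    and hom: "homeomorphism (- cball 0 1) (outside X) F G"
    using cb by (auto simp: ccw_outer_boundary_def)
  \<comment> \<open>Polar coordinates on the closed outer domain: \<open>r\<close> is the radius and
    \<open>s\<close> the fraction of a turn counted from \<open>t1\<close>. The four given points
    have radius 1 and fractions \<open>0\<close>, \<open>a\<close>, \<open>b\<close>,
    \<open>c\<close>.\<close>
  define h where "h = (\<lambda>r s. F (of_real r * cis (t1 + 2 * pi * s)))"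
  define sc where "sc = (\<lambda>t. (t - t1) / (2 * pi))"
  define a b c where "a = sc t2" and "b = sc t3" and "c = sc t4"
  have F_h: "F (cis t) = h 1 (sc t)" for t by (simp add: h_def sc_def)
  have ord: "0 < a" "a < b" "b < c" "c < 1"
    using t by (auto simp: a_def b_def c_def sc_def divide_simps)
  have hout: "h r s \<in> outside X" if "r > 1" for r s
    using hom that by (auto simp: homeomorphism_def norm_mult h_def)
  have hX: "h r s \<notin> X" if "r > 1" for r s
    using hout[OF that] outside_no_overlap by blast
  have injF: "inj_on F (- cball 0 1)"
    using hom by (metis homeomorphism_def inj_on_inverseI)
  have h_inj: "s = s'" if "h r s = h r' s'" "r > 1" "r' > 1" "0 < s" "s < 1" "0 \<le> s'" "s' \<le> 1" for r s r' s'
  proof -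
    have eq: "of_real r * cis (t1 + 2 * pi * s) = of_real r' * cis (t1 + 2 * pi * s')"
      by (rule inj_onD[OF injF]) (use that in \<open>auto simp: h_def norm_mult\<close>)
    then have "norm (of_real r * cis (t1 + 2 * pi * s)) = norm (of_real r' * cis (t1 + 2 * pi * s'))"
      by simp
    then have "r = r'" using that by (simp add: norm_mult)
    with eq have "cis (t1 + 2 * pi * s) = cis (t1 + 2 * pi * s')" using that by simp
    then show ?thesis by (rule cis_turn_eq) (use that in auto)
  qed
  have h_ray: "continuous_on {1..} (\<lambda>r. h r s)" for s
    unfolding h_def
    by (rule continuous_on_compose2[OF cont]) (auto intro!: continuous_intros simp: norm_mult)
  have h_per: "h r 1 = h r 0" for r by (simp add: h_def flip: cis_mult)
  define ray where "ray = (\<lambda>s x. h (1 + x) s)"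
  define g where "g = h 2"
  have path_ray: "path (ray s)" for s
    unfolding path_def ray_def by (rule continuous_on_compose2[OF h_ray]) (auto intro!: continuous_intros)
  have path_g: "path g"
    unfolding path_def g_def h_def
    by (rule continuous_on_compose2[OF cont]) (auto intro!: continuous_intros simp: norm_mult)
  have ray_ends [simp]: "pathstart (ray s) = h 1 s" "pathfinish (ray s) = g s" for s
    by (auto simp: pathstart_def pathfinish_def ray_def g_def)
  have p_ends [simp]: "pathstart p = h 1 0" "pathfinish p = h 1 b"
    using p by (simp_all add: F_h b_def) (simp add: sc_def)
  have g01: "g 1 = g 0" by (simp add: g_def h_per)
  have img_ray: "path_image (ray s) = (\<lambda>r. h r s) ` {1..2}" for s
  proof -
    have "path_image (ray s) = (\<lambda>r. h r s) ` ((+) 1 ` {0..1})"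
      unfolding path_image_def ray_def image_image ..
    then show ?thesis by simp
  qed
  have img_g: "path_image (subpath u v g) = h 2 ` {u..v}" if "u \<le> v" for u v
    using that by (simp add: path_image_subpath g_def)
  define q2 q4 where "q2 = h 1 a" and "q4 = h 1 c"
  have q2: "q2 \<in> Q" and q4: "q4 \<in> Q" using Q by (simp_all add: F_h q2_def q4_def a_def c_def)
  have p0: "h 1 0 \<in> path_image p" "h 1 b \<in> path_image p"
    using pathstart_in_path_image[of p] pathfinish_in_path_image[of p] by auto
  define inner where "inner = subpath 0 b g"
  define rest where "rest = subpath b 1 g"
  have pg: "path inner" "path rest" "pathstart inner = g 0" "pathfinish inner = g b"
    "pathstart rest = g b" "pathfinish rest = g 0"
    using path_g ord by (auto simp: inner_def rest_def g01 path_subpath)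
  \<comment> \<open>Both loops run along \<open>p\<close>, leave along the ray at \<open>b\<close>
    and return along the ray at \<open>0\<close>. They differ in the arc of the circle of radius 2
    between the two rays: \<open>C1\<close> goes backwards from \<open>b\<close> to
    \<open>0\<close>, \<open>C2\<close> forwards from \<open>b\<close> to \<open>1\<close>.\<close>
  define C1 where "C1 = p +++ (ray b +++ (reversepath inner +++ reversepath (ray 0)))"
  define C2 where "C2 = p +++ (ray b +++ (rest +++ reversepath (ray 0)))"
  have path_C: "path C1" "path C2" and loop_C: "pathfinish C1 = pathstart C1" "pathfinish C2 = pathstart C2"
    using p(1) path_ray pg by (auto simp: C1_def C2_def)
  have img_C1: "path_image C1 = path_image p \<union> path_image (ray b) \<union> path_image inner \<union> path_image (ray 0)"
    unfolding C1_def using pg by (simp add: path_image_join Un_assoc)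
  have img_C2: "path_image C2 = path_image p \<union> path_image (ray b) \<union> path_image rest \<union> path_image (ray 0)"
    unfolding C2_def using pg by (simp add: path_image_join Un_assoc)
  have img_inner: "path_image inner = h 2 ` {0..b}" "path_image rest = h 2 ` {b..1}"
    using ord by (auto simp: inner_def rest_def img_g)
  have ray_X: "path_image (ray s) \<inter> X \<subseteq> {h 1 s}" for s
    using hX by (force simp: img_ray)
  \<comment> \<open>Beyond radius 1 everything lies in the outer face, and the rays start at the end
    points of \<open>p\<close>. So the loops meet \<open>X\<close>, and in particular
    \<open>Q\<close>, at most along \<open>p\<close>.\<close>
  have CX: "path_image C1 \<inter> X \<subseteq> path_image p" "path_image C2 \<inter> X \<subseteq> path_image p"
    using ray_X[of b] ray_X[of 0] p0 hX[of 2] unfolding img_C1 img_C2 img_inner by auto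
  have CQ: "path_image C1 \<inter> Q = {}" "path_image C2 \<inter> Q = {}"
    using CX disj Q by auto
  \<comment> \<open>The whole ray at \<open>s\<close>, continued to infinite radius, is a connected
    unbounded set. It misses the loop if its fraction \<open>s\<close> is neither \<open>0\<close>
    nor \<open>b\<close> and does not belong to the arc \<open>I\<close> used by the loop.\<close>
  have escape: "h 1 s \<in> outside (path_image C)"
    if C: "path_image C = path_image p \<union> path_image (ray b) \<union> h 2 ` I \<union> path_image (ray 0)"
      and I: "I \<subseteq> {0..1}" "s \<notin> I" and s: "0 < s" "s < 1" "s \<noteq> b" "h 1 s \<in> Q" and CQ: "path_image C \<inter> Q = {}" for C I s
  proof -
    define L where "L = (\<lambda>r. h r s) ` {1..}"
    have conL: "connected L"
      unfolding L_def by (intro connected_continuous_image h_ray connected_Ici)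
    have LC: "L \<inter> path_image C = {}"
    proof -
      have "h r s \<notin> path_image C" if r: "r \<ge> 1" for r
      proof (cases "r = 1")
        case True
        then show ?thesis using s CQ by auto
      next
        \<comment> \<open>Beyond radius 1 the map is injective, so different fractions of a turn
          give different points; the part of the loop inside \<open>X\<close> is missed because the
          point is in the outer face.\<close>
        case False
        then have r1: "r > 1" using r by simp
        have ne: "h r s \<noteq> h r' s'" if "r' \<ge> 1" "s' \<noteq> s" "0 \<le> s'" "s' \<le> 1" "h 1 s' \<in> X" for r' s'
          using h_inj[of r s r' s'] hX[OF r1, of s] that r1 s by (cases "r' = 1") (auto dest: sym)
        have nr: "h r s \<notin> path_image (ray s')"
          if "s' \<noteq> s" "0 \<le> s'" "s' \<le> 1" "h 1 s' \<in> X" for s'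
          unfolding img_ray image_iff using ne[OF _ that] by (metis atLeastAtMost_iff)
        have "h r s \<noteq> h 2 s'" if "s' \<in> I" for s'
          using h_inj[of r s 2 s'] that r1 s I by force
        moreover have "h r s \<notin> path_image p" using hX[OF r1] p by auto
        ultimately show ?thesis
          using nr[of b] nr[of 0] ord s p0 p(2) by (auto simp: C)
      qed
      then show ?thesis unfolding L_def by blast
    qed
    have unb: "\<not> bounded L"
    proof
      assume "bounded L"
      then obtain B where B: "\<And>x. x \<in> L \<Longrightarrow> norm x \<le> B" by (auto simp: bounded_iff)
      obtain R where R: "\<And>z. norm z > R \<Longrightarrow> norm (F z) > B"
        using outer_map_escapes[OF X cont hom] by blast
      define r where "r = max 1 (R + 1)"
      have "norm (h r s) > B" unfolding h_def by (rule R) (auto simp: r_def norm_mult)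
      moreover have "h r s \<in> L" by (auto simp: L_def r_def)
      ultimately show False using B by fastforce
    qed
    have hL: "h 1 s \<in> L" by (auto simp: L_def)
    then have "L \<subseteq> connected_component_set (- path_image C) (h 1 s)"
      using conL LC by (intro connected_component_maximal) auto
    then have "\<not> bounded (connected_component_set (- path_image C) (h 1 s))"
      using unb bounded_subset by blast
    then show ?thesis using hL LC by (auto simp: outside_def)
  qed
  have w1: "winding_number C1 q4 = 0"
    unfolding q4_def using path_C loop_C CQ q4 ord
    by (intro winding_number_zero_in_outside escape[of _ "{0..b}"]) (auto simp: q4_def img_C1 img_inner)
  have w2: "winding_number C2 q2 = 0"
    unfolding q2_def using path_C loop_C CQ q2 ord
    by (intro winding_number_zero_in_outside escape[of _ "{b..1}"]) (auto simp: q2_def img_C2 img_inner)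
  have w12: "winding_number C1 q2 = winding_number C1 q4"
    using winding_number_eq[OF path_C(1) loop_C(1) q2 q4 Q(1)] CQ by blast
  have nin: "q2 \<notin> path_image p" "q2 \<notin> path_image (ray b)" "q2 \<notin> path_image (ray 0)"
    "q2 \<notin> path_image inner" "q2 \<notin> path_image rest"
    using CQ q2 unfolding img_C1 img_C2 by auto
  have d1: "winding_number C1 q2 = winding_number p q2 + winding_number (ray b) q2
     - winding_number inner q2 - winding_number (ray 0) q2"
    unfolding C1_def using p(1) path_ray pg nin
    by (simp add: winding_number_join path_image_join winding_number_reversepath)
  have d2: "winding_number C2 q2 = winding_number p q2 + winding_number (ray b) q2
     + winding_number rest q2 - winding_number (ray 0) q2"
    unfolding C2_def using p(1) path_ray pg nin
    by (simp add: winding_number_join path_image_join winding_number_reversepath)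
  have "q2 \<notin> path_image g"
    using hX[of 2] q2 Q by (auto simp: path_image_def g_def)
  then have "winding_number inner q2 + winding_number rest q2 = winding_number g q2"
    unfolding inner_def rest_def using winding_number_subpath_combine[OF path_g, of q2 0 b 1] ord by simp
  also have "\<dots> = 1"
    unfolding g_def h_def using winding_number_outer_circle[OF cb, of q2 2 t1] q2 Q by auto
  \<comment> \<open>The contributions of \<open>p\<close> and of the rays cancel, and the two arcs
    add up to the circle.\<close>
  finally have "winding_number C2 q2 - winding_number C1 q2 = 1"
    unfolding d1 d2 by (simp add: algebra_simps)
  then show False using w1 w2 w12 by simp
qed

section \<open>Clusters in plane graphs\<close>

definition adj :: "'a set set \<Rightarrow> ('a \<times> 'a) set" where
  "adj H = {(x, y). {x, y} \<in> H}"

lemma sym_adj: "sym (adj H)"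
  by (auto simp: adj_def sym_def insert_commute)

lemma adj_rtrancl_sym: "(x, y) \<in> (adj H)\<^sup>* \<Longrightarrow> (y, x) \<in> (adj H)\<^sup>*"
  by (metis sym_adj sym_rtrancl symD)

lemma finite_simple_graph_finite_edges: "finite_simple_graph V E \<Longrightarrow> finite E"
  unfolding finite_simple_graph_def by (meson Pow_iff finite_Pow_iff finite_subset subsetI)

lemma compact_drawing:
  assumes "finite_simple_graph V E" "plane_embedding V E pos \<gamma>"
  shows "compact (drawing V E pos \<gamma>)"
proof -
  have "finite V" "finite E"
    using assms finite_simple_graph_finite_edges by (auto simp: finite_simple_graph_def)
  moreover have "compact (path_image (\<gamma> e))" if "e \<in> E" for e
    using assms(2) that by (auto simp: plane_embedding_def intro: compact_path_image arc_imp_path)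
  ultimately show ?thesis
    unfolding drawing_def by (simp add: compact_Un compact_UN finite_imp_compact)
qed

text \<open>The drawn component of \<open>x\<close> in the graph with edge set \<open>H\<close>. The
  point \<open>pos x\<close> is added for the case that \<open>x\<close> is isolated and no arc
  contains it.\<close>

definition cluster_drawing ::
    "'a set set \<Rightarrow> ('a \<Rightarrow> complex) \<Rightarrow> ('a set \<Rightarrow> real \<Rightarrow> complex) \<Rightarrow> 'a \<Rightarrow> complex set" where
  "cluster_drawing H pos \<gamma> x =
     insert (pos x) (\<Union>e\<in>{e \<in> H. e \<subseteq> (adj H)\<^sup>* `` {x}}. path_image (\<gamma> e))"

lemma cluster_drawing_subset:
  "H \<subseteq> E \<Longrightarrow> x \<in> V \<Longrightarrow> cluster_drawing H pos \<gamma> x \<subseteq> drawing V E pos \<gamma>"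
  by (auto simp: cluster_drawing_def drawing_def)

lemma path_component_cluster_drawing:
  assumes pe: "plane_embedding V E pos \<gamma>" and H: "H \<subseteq> E" and xy: "(x, y) \<in> (adj H)\<^sup>*"
  shows "path_component (cluster_drawing H pos \<gamma> x) (pos x) (pos y)"
  using xy
proof (induction rule: rtrancl_induct)
  case base
  show ?case by (rule path_component_refl) (simp add: cluster_drawing_def)
next
  case (step y z)
  have e: "{y, z} \<in> H" using step.hyps(2) by (simp add: adj_def)
  have sub: "path_image (\<gamma> {y, z}) \<subseteq> cluster_drawing H pos \<gamma> x"
    using e step.hyps by (auto simp: cluster_drawing_def intro: rtrancl_into_rtrancl)
  have arc: "arc (\<gamma> {y, z})" and img: "path_image (\<gamma> {y, z}) \<inter> pos ` V = pos ` {y, z}"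
    using pe subsetD[OF H e] unfolding plane_embedding_def by meson+
  have "path_connected (path_image (\<gamma> {y, z}))"
    using arc by (intro path_connected_path_image arc_imp_path)
  then have "path_component (path_image (\<gamma> {y, z})) (pos y) (pos z)"
    using img unfolding path_connected_component by blast
  then show ?case
    using path_component_trans[OF step.IH path_component_of_subset[OF sub]] by simp
qed

text \<open>Edges of different clusters share no end point, and in a plane embedding arcs meet other
  arcs and vertices only at end points.\<close>

lemma disjoint_cluster_drawings:
  assumes G: "finite_simple_graph V E" and pe: "plane_embedding V E pos \<gamma>"
    and H: "H \<subseteq> E" and V: "x \<in> V" "y \<in> V" and xy: "(x, y) \<notin> (adj H)\<^sup>*"
  shows "cluster_drawing H pos \<gamma> x \<inter> cluster_drawing H pos \<gamma> y = {}"
proof -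
  let ?C = "\<lambda>x. (adj H)\<^sup>* `` {x}"
  have disj: "?C x \<inter> ?C y = {}"
    using xy by (auto dest: adj_rtrancl_sym rtrancl_trans)
  have ne: "pos x \<noteq> pos y"
    using pe V xy by (auto simp: plane_embedding_def inj_on_def)
  have vtx: "pos u \<notin> path_image (\<gamma> e)" if "u \<in> V" "u \<notin> e" "e \<in> H" for u e
  proof
    assume "pos u \<in> path_image (\<gamma> e)"
    then have "pos u \<in> pos ` e"
      using pe subsetD[OF H that(3)] imageI[OF that(1), of pos] unfolding plane_embedding_def by blast
    moreover have "e \<subseteq> V" using G H that by (auto simp: finite_simple_graph_def)
    ultimately have "u \<in> e" using pe that by (auto simp: plane_embedding_def inj_on_def subset_iff)
    with that show False by simp
  qed
  have "path_image (\<gamma> e) \<inter> path_image (\<gamma> e') = {}"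
    if "e \<in> H" "e' \<in> H" "e \<subseteq> ?C x" "e' \<subseteq> ?C y" for e e'
  proof -
    have "e \<inter> e' = {}" using that disj by blast
    \<comment> \<open>Disjoint edges are distinct because edges are nonempty; only then does the
      embedding condition on pairs of different edges apply.\<close>
    moreover have "card e = 2" using G subsetD[OF H that(1)] by (auto simp: finite_simple_graph_def)
    then have "e \<noteq> {}" by auto
    ultimately have "e \<noteq> e'" by auto
    then have "path_image (\<gamma> e) \<inter> path_image (\<gamma> e') = pos ` (e \<inter> e')"
      using pe subsetD[OF H that(1)] subsetD[OF H that(2)] unfolding plane_embedding_def by meson
    then show ?thesis using \<open>e \<inter> e' = {}\<close> by simp
  qed
  moreover have "pos x \<notin> path_image (\<gamma> e)" if "e \<in> H" "e \<subseteq> ?C y" for e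
    using vtx[OF V(1) _ that(1)] that(2) disj by blast
  moreover have "pos y \<notin> path_image (\<gamma> e)" if "e \<in> H" "e \<subseteq> ?C x" for e
    using vtx[OF V(2) _ that(1)] that(2) disj by blast
  ultimately show ?thesis
    using ne unfolding cluster_drawing_def by (simp add: disjoint_iff) blast
qed

text \<open>If the two clusters were different, their drawings would be disjoint, whereas the
  crossing lemma makes paths inside these drawings meet.\<close>

lemma outer_vertices_noncrossing:
  assumes G: "finite_simple_graph V E" and pe: "plane_embedding V E pos \<gamma>"
    and ord: "ccw_outer_order (drawing V E pos \<gamma>) (map pos ws)" and wsV: "set ws \<subseteq> V"
    and H: "H \<subseteq> E"
    and ijkl: "i < j" "j < k" "k < l" "l < length ws"
    and ik: "(ws ! i, ws ! k) \<in> (adj H)\<^sup>*" and jl: "(ws ! j, ws ! l) \<in> (adj H)\<^sup>*"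
  shows "(ws ! i, ws ! j) \<in> (adj H)\<^sup>*"
proof (rule ccontr)
  assume nij: "(ws ! i, ws ! j) \<notin> (adj H)\<^sup>*"
  let ?X = "drawing V E pos \<gamma>" and ?D = "cluster_drawing H pos \<gamma>"
  obtain F t0 ts where cb: "ccw_outer_boundary ?X F" and st: "sorted_wrt (<) ts"
    and ts: "set ts \<subseteq> {t0..<t0 + 2 * pi}" and eq: "map pos ws = map (\<lambda>t. F (cis t)) ts"
    using ord unfolding ccw_outer_order_def by blast
  have len: "length ts = length ws" using eq by (metis length_map)
  have F: "F (cis (ts ! m)) = pos (ws ! m)" if "m < length ws" for m
    using eq that len by (metis nth_map)
  have inV: "ws ! m \<in> V" if "m < length ws" for m using that wsV by auto
  obtain p where p: "path p" "path_image p \<subseteq> ?D (ws ! i)"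
    "pathstart p = pos (ws ! i)" "pathfinish p = pos (ws ! k)"
    using path_component_cluster_drawing[OF pe H ik] by (auto simp: path_component_def)
  obtain q where q: "path q" "path_image q \<subseteq> ?D (ws ! j)"
    "pathstart q = pos (ws ! j)" "pathfinish q = pos (ws ! l)"
    using path_component_cluster_drawing[OF pe H jl] by (auto simp: path_component_def)
  have D: "?D (ws ! m) \<subseteq> ?X" if "m < length ws" for m
    using cluster_drawing_subset[OF H inV[OF that]] .
  have "path_image p \<inter> path_image q \<noteq> {}"
  proof (rule ccw_outer_boundary_crossing[OF compact_drawing[OF G pe] cb p(1)])
    show "path_image p \<subseteq> ?X" "path_image q \<subseteq> ?X"
      using p(2) q(2) D ijkl by (meson less_trans order_trans)+
    show "pathstart p = F (cis (ts ! i))" "pathfinish p = F (cis (ts ! k))"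
      using p F ijkl by auto
    show "connected (path_image q)" using q by (simp add: connected_path_image)
    show "F (cis (ts ! j)) \<in> path_image q" "F (cis (ts ! l)) \<in> path_image q"
      using q F ijkl pathstart_in_path_image[of q] pathfinish_in_path_image[of q] by auto
    show "ts ! i < ts ! j" "ts ! j < ts ! k" "ts ! k < ts ! l"
      using st ijkl len by (auto intro: sorted_wrt_nth_less)
    have "ts ! i \<in> {t0..<t0 + 2 * pi}" "ts ! l \<in> {t0..<t0 + 2 * pi}"
      using ts ijkl len by (metis less_trans nth_mem subsetD)+
    then show "ts ! l < ts ! i + 2 * pi" by auto
  qed
  moreover have "?D (ws ! i) \<inter> ?D (ws ! j) = {}"
    using disjoint_cluster_drawings[OF G pe H inV inV nij] ijkl by auto
  ultimately show False using p(2) q(2) by blast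
qed

section \<open>From vertices on the outer face to nodes\<close>

lemma node_list_Cons:
  "node_list D (w # ws) = (if w \<in> D then [Lower w, Upper w] else [Single w]) @ node_list D ws"
  by (simp add: node_list_def)

text \<open>The index map from nodes to vertices is monotone, which transfers the boundary order. It
  is not injective, as the two copies of a doubled vertex have the same image.\<close>

lemma node_list_vertex_index:
  "\<exists>g. (\<forall>i<length (node_list D ws). g i < length ws \<and> vertex (node_list D ws ! i) = ws ! g i) \<and>
     (\<forall>i j. i \<le> j \<longrightarrow> j < length (node_list D ws) \<longrightarrow> g i \<le> g j)"
proof (induction ws)
  case Nil
  show ?case by (simp add: node_list_def)
next
  case (Cons w ws)
  then obtain g where g:
    "\<forall>i<length (node_list D ws). g i < length ws \<and> vertex (node_list D ws ! i) = ws ! g i"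
    "\<forall>i j. i \<le> j \<longrightarrow> j < length (node_list D ws) \<longrightarrow> g i \<le> g j" by (elim exE conjE)
  \<comment> \<open>The number of nodes that the head of the list contributes.\<close>
  define d :: nat where "d = (if w \<in> D then 2 else 1)"
  define g' where "g' = (\<lambda>i. if i < d then 0 else Suc (g (i - d)))"
  have len: "length (node_list D (w # ws)) = d + length (node_list D ws)"
    by (simp add: node_list_Cons d_def)
  have "g' i < length (w # ws) \<and> vertex (node_list D (w # ws) ! i) = (w # ws) ! g' i"
    if "i < length (node_list D (w # ws))" for i
  proof (cases "i < d")
    case True
    then show ?thesis
      by (auto simp: g'_def node_list_Cons nth_append d_def less_Suc_eq numeral_2_eq_2)
  next
    case False
    then have "i - d < length (node_list D ws)" using that len by auto
    then show ?thesis
      using g(1)[rule_format, of "i - d"] False by (auto simp: g'_def node_list_Cons nth_append d_def numeral_2_eq_2)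
  qed
  moreover have "g' i \<le> g' j" if "i \<le> j" "j < length (node_list D (w # ws))" for i j
    using that g(2)[rule_format, of "i - d" "j - d"] len by (auto simp: g'_def)
  ultimately show ?case by blast
qed

lemma outer_nodes_noncrossing:
  assumes G: "finite_simple_graph V E" and pe: "plane_embedding V E pos \<gamma>"
    and ord: "ccw_outer_order (drawing V E pos \<gamma>) (map pos ws)" and wsV: "set ws \<subseteq> V"
    and H: "H \<subseteq> E"
    and v: "v = (\<lambda>i. vertex (node_list D ws ! i))"
    and ijkl: "i < j" "j < k" "k < l" "l < length (node_list D ws)"
    and ik: "(v i, v k) \<in> (adj H)\<^sup>*" and jl: "(v j, v l) \<in> (adj H)\<^sup>*"
  shows "(v i, v j) \<in> (adj H)\<^sup>*"
proof -
  obtain g where g: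
    "\<forall>i<length (node_list D ws). g i < length ws \<and> vertex (node_list D ws ! i) = ws ! g i"
    "\<forall>i j. i \<le> j \<longrightarrow> j < length (node_list D ws) \<longrightarrow> g i \<le> g j"
    using node_list_vertex_index[of D ws] by (elim exE conjE)
  have vg: "v m = ws ! g m" "g m < length ws" if "m \<le> l" for m
    using g(1)[rule_format, of m] that ijkl v by auto
  have le: "g i \<le> g j" "g j \<le> g k" "g k \<le> g l" using g(2) ijkl by auto
  \<comment> \<open>If two consecutive nodes among the four are copies of one vertex, the claim is
    trivial or follows from symmetry and transitivity. Otherwise there are four different positions
    in \<open>ws\<close>.\<close>
  consider "g i = g j" | "g j = g k" | "g k = g l" | "g i < g j" "g j < g k" "g k < g l"
    using le by linarith
  then show ?thesis
  proof cases
    case 1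
    then show ?thesis using vg ijkl by simp
  next
    case 2
    then show ?thesis using ik vg ijkl by simp
  next
    case 3
    then have "(v j, v k) \<in> (adj H)\<^sup>*" using jl vg ijkl by simp
    then show ?thesis using ik adj_rtrancl_sym rtrancl_trans by metis
  next
    case 4
    then show ?thesis
      using outer_vertices_noncrossing[OF G pe ord wsV H 4(1,2,3)] ik jl vg ijkl by simp
  qed
qed

section \<open>Noncrossing partitions and sums of products of Pfaffians\<close>

definition noncrossing :: "'a::linorder set \<Rightarrow> ('a \<Rightarrow> 'b) \<Rightarrow> bool" where
  "noncrossing S cl \<longleftrightarrow> (\<forall>i\<in>S. \<forall>j\<in>S. \<forall>k\<in>S. \<forall>l\<in>S.
     i < j \<longrightarrow> j < k \<longrightarrow> k < l \<longrightarrow> cl i = cl k \<longrightarrow> cl j = cl l \<longrightarrow> cl i = cl j)"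

lemma noncrossing_subset: "noncrossing S cl \<Longrightarrow> T \<subseteq> S \<Longrightarrow> noncrossing T cl"
  unfolding noncrossing_def by (meson subsetD)

text \<open>Take two elements of equal label at minimal distance. An element strictly between them
  would have another label by minimality. As blocks are even it has a mate: inside the gap the mate
  contradicts minimality, outside it produces a crossing.\<close>

lemma noncrossing_adjacent_pair:
  fixes S :: "nat set" and cl :: "nat \<Rightarrow> 'b"
  assumes fin: "finite S" "S \<noteq> {}"
    and nc: "noncrossing S cl"
    and ev: "\<And>c. even (card {j \<in> S. cl j = c})"
  obtains p q where "p \<in> S" "q \<in> S" "p < q" "cl p = cl q" "S \<inter> {p<..<q} = {}"
proof -
  have mate: "\<exists>y\<in>S. y \<noteq> x \<and> cl y = cl x" if "x \<in> S" for x
  proof (rule ccontr)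
    assume "\<not> ?thesis"
    then have "{j \<in> S. cl j = cl x} = {x}" using that by auto
    then show False using ev[of "cl x"] by simp
  qed
  define D where "D = (\<lambda>n. \<exists>p q. p \<in> S \<and> q \<in> S \<and> p < q \<and> cl p = cl q \<and> q - p = n)"
  obtain x where "x \<in> S" using fin by auto
  then obtain y where "y \<in> S" "y \<noteq> x" "cl y = cl x" using mate by blast
  with \<open>x \<in> S\<close> have "\<exists>n. D n" unfolding D_def by (metis nat_neq_iff)
  then have "D (LEAST n. D n)" by (rule LeastI_ex)
  then obtain p q where pq: "p \<in> S" "q \<in> S" "p < q" "cl p = cl q" "q - p = (LEAST n. D n)"
    unfolding D_def by blast
  have min: "q - p \<le> v - u" if "u \<in> S" "v \<in> S" "u < v" "cl u = cl v" for u v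
    unfolding pq(5) by (rule Least_le) (use that in \<open>auto simp: D_def\<close>)
  have "z \<notin> S" if z: "p < z" "z < q" for z
  proof
    assume "z \<in> S"
    then obtain w where w: "w \<in> S" "w \<noteq> z" "cl w = cl z" using mate by blast
    have "cl z \<noteq> cl p" using min[of p z] \<open>z \<in> S\<close> pq z by force
    then have "w \<noteq> p" "w \<noteq> q" using w pq by auto
    then consider "w < p" | "p < w" "w < z" | "z < w" "w < q" | "q < w"
      using w(2) by linarith
    then show False
    proof cases
      case 1
      then show False using nc[unfolded noncrossing_def, rule_format, of w p z q] w \<open>z \<in> S\<close> pq z \<open>cl z \<noteq> cl p\<close> by auto
    next
      case 2
      then show False using min[of w z] w \<open>z \<in> S\<close> z by auto
    next
      case 3
      then show False using min[of z w] w \<open>z \<in> S\<close> z by auto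
    next
      case 4
      then show False using nc[unfolded noncrossing_def, rule_format, of p z q w] w \<open>z \<in> S\<close> pq z \<open>cl z \<noteq> cl p\<close> by auto
    qed
  qed
  then have "S \<inter> {p<..<q} = {}" by auto
  with pq that show ?thesis by blast
qed

text \<open>Induction by removing a pair of neighbours from one block. Their terms have equal values
  and opposite signs, and the remaining partition is again noncrossing with even blocks.\<close>

lemma noncrossing_alternating_sum:
  fixes S :: "nat set" and cl :: "nat \<Rightarrow> 'b" and r :: "nat \<Rightarrow> real"
  assumes "finite S" "noncrossing S cl"
    and "\<And>c. even (card {j \<in> S. cl j = c})"
    and "\<And>i j. i \<in> S \<Longrightarrow> j \<in> S \<Longrightarrow> cl i = cl j \<Longrightarrow> r i = r j"
  shows "(\<Sum>j\<in>S. (-1) ^ card (S \<inter> {..<j}) * r j) = 0"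
  using assms
proof (induction "card S" arbitrary: S rule: less_induct)
  case less
  note fin = less.prems(1) and nc = less.prems(2) and ev = less.prems(3) and r = less.prems(4)
  show ?case
  proof (cases "S = {}")
    case False
    obtain p q where pq: "p \<in> S" "q \<in> S" "p < q" "cl p = cl q" "S \<inter> {p<..<q} = {}"
      by (rule noncrossing_adjacent_pair[OF fin False nc ev])
    define S' where "S' = S - {p, q}"
    have S: "S = insert p (insert q S')" "p \<notin> insert q S'" "q \<notin> S'" "finite S'"
      using pq fin by (auto simp: S'_def)
    have out: "j < p \<or> q < j" if "j \<in> S'" for j
      using that pq(5) unfolding S'_def by force
    \<comment> \<open>A remaining element lies below or above both removed ones, so the number of
      its predecessors changes by 0 or 2.\<close>
    have sgn: "(-1) ^ card (S \<inter> {..<j}) = (-1 :: real) ^ card (S' \<inter> {..<j})" if "j \<in> S'" for j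
    proof (cases "j < p")
      case True
      then have "S \<inter> {..<j} = S' \<inter> {..<j}" using pq by (auto simp: S'_def)
      then show ?thesis by simp
    next
      case False
      then have "q < j" using out that by auto
      then have "S \<inter> {..<j} = insert p (insert q (S' \<inter> {..<j}))" using pq by (auto simp: S'_def)
      then have "card (S \<inter> {..<j}) = 2 + card (S' \<inter> {..<j})" using S pq(3) by simp
      then show ?thesis by simp
    qed
    have "S \<inter> {..<q} = insert p (S \<inter> {..<p})"
    proof -
      have "x < p \<or> x = p" if "x \<in> S" "x < q" for x
        using that pq(5) by (metis disjoint_iff greaterThanLessThan_iff nat_neq_iff)
      then show ?thesis using pq by auto
    qed
    then have q: "card (S \<inter> {..<q}) = Suc (card (S \<inter> {..<p}))" using fin by simp
    have "(\<Sum>j\<in>S'. (-1) ^ card (S' \<inter> {..<j}) * r j) = 0"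
    proof (rule less.hyps)
      show "card S' < card S" using S by simp
      show "noncrossing S' cl" by (rule noncrossing_subset[OF nc]) (simp add: S'_def)
      show "even (card {j \<in> S'. cl j = c})" for c
      proof (cases "cl p = c")
        case True
        then have "{j \<in> S. cl j = c} = insert p (insert q {j \<in> S'. cl j = c})"
          using pq by (auto simp: S'_def)
        then have "card {j \<in> S. cl j = c} = 2 + card {j \<in> S'. cl j = c}" using S by simp
        then show ?thesis using ev[of c] by simp
      next
        case False
        then have "{j \<in> S. cl j = c} = {j \<in> S'. cl j = c}" using pq by (auto simp: S'_def)
        then show ?thesis using ev[of c] by simp
      qed
      show "r i = r j" if "i \<in> S'" "j \<in> S'" "cl i = cl j" for i j
        using r that by (auto simp: S'_def)
    qed (use S in auto)
    moreover have sum_S: "sum f S = f p + (f q + sum f S')" for f :: "nat \<Rightarrow> real"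
      by (subst S(1)) (use S in simp)
    ultimately show ?thesis using sgn q r[OF pq(1,2,4)] by (simp add: sum_S cong: sum.cong)
  qed simp
qed

section \<open>The signed sum over two replicas\<close>

text \<open>This comes from expanding a product of terms \<sigma> plus or minus \<tau> over
  \<open>S\<close>, where \<open>T\<close> collects the factors \<sigma>. The sign of a factor
  \<tau> is split into an alternating part, relative to the current set \<open>S\<close>, and a
  fixed part \<open>d\<close>, which will be \<open>-1\<close> at sources and \<open>1\<close> at
  sinks.\<close>

definition two_replica_sum :: "(nat \<Rightarrow> real) \<Rightarrow> (nat set \<Rightarrow> real) \<Rightarrow> nat set \<Rightarrow> real" where
  "two_replica_sum d c S =
     (\<Sum>T\<in>Pow S. (\<Prod>i\<in>S - T. d i * (-1) ^ card (S \<inter> {..<i})) * c T * c (S - T))"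

lemma sum_Pow_complement:
  "(\<Sum>T\<in>Pow S. f (S - T) T) = (\<Sum>T\<in>Pow S. f T (S - T))"
  by (rule sum.reindex_bij_witness[of _ "\<lambda>T. S - T" "\<lambda>T. S - T"]) (auto simp: double_diff)

text \<open>Subsets are paired with their complements, and each pair is represented by the member
  containing \<open>m\<close>. This always gives a factor to which an expansion along
  \<open>m\<close> applies.\<close>

lemma sum_Pow_split:
  fixes f :: "'b set \<Rightarrow> 'b set \<Rightarrow> real"
  assumes "finite S" "m \<in> S"
  shows "(\<Sum>T\<in>Pow S. f T (S - T)) = (\<Sum>T\<in>{T \<in> Pow S. m \<in> T}. f T (S - T) + f (S - T) T)"
proof -
  have "(\<Sum>T\<in>Pow S. f T (S - T)) = (\<Sum>T\<in>{T \<in> Pow S. m \<in> T}. f T (S - T)) + (\<Sum>T\<in>{T \<in> Pow S. m \<notin> T}. f T (S - T))"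
    using assms by (subst sum.union_disjoint[symmetric]) (auto intro!: sum.cong)
  also have "(\<Sum>T\<in>{T \<in> Pow S. m \<notin> T}. f T (S - T)) = (\<Sum>T\<in>{T \<in> Pow S. m \<in> T}. f (S - T) T)"
    by (rule sum.reindex_bij_witness[of _ "\<lambda>T. S - T" "\<lambda>T. S - T"]) (use assms in \<open>auto simp: double_diff\<close>)
  finally show ?thesis by (simp add: sum.distrib)
qed

text \<open>Pair each \<open>T\<close> with its complement so that \<open>m\<close> is in
  \<open>T\<close>, and expand \<open>c T\<close> along \<open>m\<close>. After removal of
  \<open>m\<close> and \<open>j\<close>, the signs of the elements between them combine with the
  sign of the expansion to one sign depending on \<open>S\<close> only. The two ways of distributing
  the replicas contribute \<open>1\<close> and \<open>- d m * d j\<close>. For \<open>d\<close> with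
  values \<open>1\<close> and \<open>-1\<close>, only opposite values at \<open>m\<close> and
  \<open>j\<close> are coupled.\<close>

lemma two_replica_sum_recursion:
  fixes c :: "nat set \<Rightarrow> real" and a :: "nat \<Rightarrow> nat \<Rightarrow> real"
  assumes fin: "finite S" "S \<noteq> {}" and m: "m = Min S"
    and pf: "\<And>T. T \<subseteq> S \<Longrightarrow> m \<in> T \<Longrightarrow>
      c T = (\<Sum>j\<in>T - {m}. (-1) ^ card (T \<inter> {m<..<j}) * a m j * c (T - {m, j}))"
  shows "two_replica_sum d c S =
    (\<Sum>j\<in>S - {m}. (1 - d m * d j) * (-1) ^ card (S \<inter> {m<..<j}) * a m j * two_replica_sum d c (S - {m, j}))"
proof -
  define eps where "eps = (\<lambda>S i. d i * (-1 :: real) ^ card (S \<inter> {..<i}))"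
  have mS: "m \<in> S" "\<And>i. i \<in> S \<Longrightarrow> m \<le> i" using fin m by auto
  have X: "two_replica_sum d c U = (\<Sum>T\<in>Pow U. prod (eps U) (U - T) * c T * c (U - T))" for U
    by (simp add: two_replica_sum_def eps_def)
  have lt: "m < i" if "i \<in> S" "i \<noteq> m" for i using mS(2)[of i] that by simp
  \<comment> \<open>The total sign of the splitting: the replica \<tau> lives on the complement of
    \<open>T\<close> in the first term and on \<open>T\<close> in the second.\<close>
  define W where "W = (\<lambda>T. prod (eps S) (S - T) + prod (eps S) T)"
  have "two_replica_sum d c S = (\<Sum>T\<in>{T \<in> Pow S. m \<in> T}. W T * c T * c (S - T))"
    unfolding X
    by (subst sum_Pow_split[where f = "\<lambda>T U. prod (eps S) U * c T * c U", OF fin(1) mS(1)])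
      (simp add: W_def algebra_simps)
  also have "\<dots> = (\<Sum>T\<in>{T \<in> Pow S. m \<in> T}. \<Sum>j\<in>S - {m}. if j \<in> T then
      W T * ((-1) ^ card (T \<inter> {m<..<j}) * a m j * c (T - {m, j})) * c (S - T) else 0)"
  proof (rule sum.cong[OF refl])
    fix T assume T: "T \<in> {T \<in> Pow S. m \<in> T}"
    have "{j \<in> S - {m}. j \<in> T} = T - {m}" using T by auto
    then show "W T * c T * c (S - T) = (\<Sum>j\<in>S - {m}. if j \<in> T then
      W T * ((-1) ^ card (T \<inter> {m<..<j}) * a m j * c (T - {m, j})) * c (S - T) else 0)"
      using T pf[of T] fin(1) by (simp add: sum.inter_filter[symmetric] sum_distrib_left sum_distrib_right)
  qed
  also have "\<dots> = (\<Sum>j\<in>S - {m}. \<Sum>T\<in>{T \<in> Pow S. m \<in> T}. if j \<in> T then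
      W T * ((-1) ^ card (T \<inter> {m<..<j}) * a m j * c (T - {m, j})) * c (S - T) else 0)"
    by (rule sum.swap)
  also have "\<dots> = (\<Sum>j\<in>S - {m}. (1 - d m * d j) * (-1) ^ card (S \<inter> {m<..<j}) * a m j *
      two_replica_sum d c (S - {m, j}))"
  proof (rule sum.cong[OF refl])
    fix j assume j: "j \<in> S - {m}"
    define S' where "S' = S - {m, j}"
    define I where "I = {m<..<j}"
    define s where "s = (-1 :: real) ^ card (S \<inter> I)"
    have mj: "m < j" using j mS by (metis Diff_iff insertCI le_neq_implies_less)
    have S: "S = insert m (insert j S')" "m \<noteq> j" "m \<notin> S'" "j \<notin> S'" "finite S'"
      using j mS fin by (auto simp: S'_def)
    have SI: "S \<inter> I = S' \<inter> I" by (auto simp: S'_def I_def)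
    \<comment> \<open>Removing \<open>m\<close> and \<open>j\<close> takes one predecessor from the
      elements between them and two from those beyond \<open>j\<close>.\<close>
    have eps_i: "eps S i = eps S' i * (if i \<in> I then -1 else 1)" if "i \<in> S'" for i
    proof -
      have mi: "m < i" using that S mS(2)[of i] by (metis insertCI le_neq_implies_less)
      show ?thesis
      proof (cases "j < i")
        case True
        then have "S \<inter> {..<i} = insert m (insert j (S' \<inter> {..<i}))" using mi S by auto
        then have "card (S \<inter> {..<i}) = 2 + card (S' \<inter> {..<i})" using S by simp
        then show ?thesis using True by (simp add: eps_def I_def)
      next
        case False
        then have "j > i" using that S by (metis nat_neq_iff)
        then have "S \<inter> {..<i} = insert m (S' \<inter> {..<i})" using mi S by auto
        then have "card (S \<inter> {..<i}) = Suc (card (S' \<inter> {..<i}))" using S by simp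
        then show ?thesis using \<open>j > i\<close> mi by (simp add: eps_def I_def)
      qed
    qed
    have prod_eps: "prod (eps S) U = prod (eps S') U * (-1) ^ card (U \<inter> I)" if "U \<subseteq> S'" for U
    proof -
      have fU: "finite U" using that S finite_subset by blast
      have "prod (eps S) U = (\<Prod>i\<in>U. eps S' i * (if i \<in> I then -1 else 1))"
        using eps_i that by (intro prod.cong) auto
      also have "\<dots> = prod (eps S') U * (\<Prod>i\<in>U. if i \<in> I then -1 else 1)" by (rule prod.distrib)
      also have "(\<Prod>i\<in>U. if i \<in> I then -1 else 1 :: real) = (\<Prod>i\<in>U \<inter> I. -1)"
        by (rule prod.inter_restrict[OF fU, symmetric])
      finally show ?thesis by simp
    qed
    have epsm: "eps S m = d m"
    proof -
      have "S \<inter> {..<m} = {}" using mS(2) by force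
      then show ?thesis by (simp add: eps_def)
    qed
    have epsj: "eps S j = - d j * s"
    proof -
      have "S \<inter> {..<j} = insert m (S \<inter> I)" using mS(1) mj lt by (auto simp: I_def)
      then have "card (S \<inter> {..<j}) = Suc (card (S \<inter> I))" using fin by (simp add: I_def)
      then show ?thesis by (simp add: eps_def s_def)
    qed
    \<comment> \<open>The elements between \<open>m\<close> and \<open>j\<close> are distributed
      over the two replicas, so the product of the two signs does not depend on the
      splitting.\<close>
    have ss: "(-1 :: real) ^ card (U \<inter> I) * (-1) ^ card ((S' - U) \<inter> I) = s" if "U \<subseteq> S'" for U
    proof -
      have "S' \<inter> I = (U \<inter> I) \<union> ((S' - U) \<inter> I)" using that by auto
      moreover have "card \<dots> = card (U \<inter> I) + card ((S' - U) \<inter> I)"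
        using S that by (intro card_Un_disjoint) (auto intro: finite_subset)
      ultimately show ?thesis by (simp add: s_def SI power_add)
    qed
    have "(\<Sum>T\<in>{T \<in> Pow S. m \<in> T}. if j \<in> T then
        W T * ((-1) ^ card (T \<inter> I) * a m j * c (T - {m, j})) * c (S - T) else 0) =
      (\<Sum>T\<in>{T \<in> Pow S. m \<in> T \<and> j \<in> T}.
        W T * ((-1) ^ card (T \<inter> I) * a m j * c (T - {m, j})) * c (S - T))"
      using fin by (subst sum.inter_filter[symmetric]) (auto intro!: sum.cong)
    also have "\<dots> = (\<Sum>U\<in>Pow S'. s * a m j * (prod (eps S') (S' - U) * c U * c (S' - U)) -
       d m * d j * s * a m j * (prod (eps S') U * c U * c (S' - U)))"
    proof (rule sum.reindex_bij_witness[of _ "\<lambda>U. insert m (insert j U)" "\<lambda>T. T - {m, j}"])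
      fix T assume T: "T \<in> {T \<in> Pow S. m \<in> T \<and> j \<in> T}"
      define U where "U = T - {m, j}"
      have U: "U \<subseteq> S'" "T = insert m (insert j U)" "m \<notin> U" "j \<notin> U" "finite U"
        using T fin by (auto simp: U_def S'_def intro: finite_subset)
      have ST: "S - T = S' - U" using T by (auto simp: S'_def U_def)
      have TI: "T \<inter> I = U \<inter> I" using U by (auto simp: I_def)
      define u v where "u = (-1 :: real) ^ card (U \<inter> I)" and "v = (-1 :: real) ^ card ((S' - U) \<inter> I)"
      have uu: "u * u = 1" by (simp add: u_def flip: power_add mult_2)
      have uv: "u * v = s" using ss[OF U(1)] by (simp add: u_def v_def)
      have "prod (eps S) T = d m * (- d j * s) * (prod (eps S') U * u)"
        unfolding U(2) u_def using U(3,4,5) S(2) prod_eps[OF U(1)] epsm epsj by simp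
      moreover have "prod (eps S) (S - T) = prod (eps S') (S' - U) * v"
        unfolding ST v_def by (rule prod_eps) auto
      ultimately have "W T * u = prod (eps S') (S' - U) * (u * v) - d m * d j * s * prod (eps S') U * (u * u)"
        by (simp add: W_def algebra_simps)
      then have W: "W T * (-1) ^ card (U \<inter> I) = s * prod (eps S') (S' - U) - d m * d j * s * prod (eps S') U"
        unfolding uu uv by (simp add: u_def algebra_simps)
      have "W T * ((-1) ^ card (T \<inter> I) * a m j * c (T - {m, j})) * c (S - T) =
        (W T * (-1) ^ card (U \<inter> I)) * a m j * c U * c (S' - U)"
        by (simp add: TI ST U_def)
      also have "\<dots> = s * a m j * (prod (eps S') (S' - U) * c U * c (S' - U)) -
        d m * d j * s * a m j * (prod (eps S') U * c U * c (S' - U))"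
        unfolding W by (simp add: algebra_simps)
      finally show "s * a m j * (prod (eps S') (S' - (T - {m, j})) * c (T - {m, j}) * c (S' - (T - {m, j}))) -
        d m * d j * s * a m j * (prod (eps S') (T - {m, j}) * c (T - {m, j}) * c (S' - (T - {m, j}))) =
        W T * ((-1) ^ card (T \<inter> I) * a m j * c (T - {m, j})) * c (S - T)"
        by (simp add: U_def)
    qed (use mS(1) j in \<open>auto simp: S'_def\<close>)
    also have "\<dots> = s * a m j * (\<Sum>U\<in>Pow S'. prod (eps S') (S' - U) * c U * c (S' - U)) -
       d m * d j * s * a m j * (\<Sum>U\<in>Pow S'. prod (eps S') U * c U * c (S' - U))"
      by (simp add: sum_subtractf sum_distrib_left)
    \<comment> \<open>Exchanging the replicas identifies the second sum with the first, which leaves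
      the common factor \<open>1 - d m * d j\<close>.\<close>
    also have "(\<Sum>U\<in>Pow S'. prod (eps S') U * c U * c (S' - U)) =
        (\<Sum>U\<in>Pow S'. prod (eps S') (S' - U) * c U * c (S' - U))"
      using sum_Pow_complement[of "\<lambda>U T. prod (eps S') U * c U * c T" S'] by (simp add: mult.commute mult.left_commute)
    also have "(\<Sum>U\<in>Pow S'. prod (eps S') (S' - U) * c U * c (S' - U)) = two_replica_sum d c S'"
      by (simp add: X)
    finally show "(\<Sum>T\<in>{T \<in> Pow S. m \<in> T}. if j \<in> T then
        W T * ((-1) ^ card (T \<inter> {m<..<j}) * a m j * c (T - {m, j})) * c (S - T) else 0) =
      (1 - d m * d j) * (-1) ^ card (S \<inter> {m<..<j}) * a m j * two_replica_sum d c (S - {m, j})"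
      unfolding I_def[symmetric] S'_def[symmetric] s_def[symmetric] by (simp add: algebra_simps)
  qed
  finally show ?thesis .
qed

section \<open>Determinants indexed by sources and sinks\<close>

lemma remove1_nth: "distinct xs \<Longrightarrow> i < length xs \<Longrightarrow> remove1 (xs ! i) xs = take i xs @ drop (Suc i) xs"
proof (induction xs arbitrary: i)
  case (Cons x xs)
  then show ?case by (cases i) auto
qed simp

lemma sorted_list_of_set_Diff_nth:
  assumes A: "finite A" and i: "i < card A" and k: "k < card A - 1"
  shows "sorted_list_of_set (A - {sorted_list_of_set A ! i}) ! k =
    sorted_list_of_set A ! (if k < i then k else Suc k)"
  using assms by (simp add: sorted_list_of_set_remove remove1_nth nth_append)

text \<open>This turns the position of a column in a Laplace expansion into a count of smaller
  elements.\<close>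

lemma card_less_sorted_list_of_set_nth:
  assumes A: "finite A" and i: "i < card A"
  shows "card {m \<in> A. m < sorted_list_of_set A ! i} = i"
proof -
  let ?xs = "sorted_list_of_set A"
  have st: "sorted_wrt (<) ?xs" by (rule strict_sorted_list_of_set)
  have len: "length ?xs = card A" and set: "set ?xs = A" using A by auto
  have less: "?xs ! j < ?xs ! i \<longleftrightarrow> j < i" if "j < card A" for j
    using st that i len sorted_wrt_nth_less[OF st, of i j] sorted_wrt_nth_less[OF st, of j i]
    by (metis less_asym nat_neq_iff)
  have "{m \<in> A. m < ?xs ! i} = (\<lambda>j. ?xs ! j) ` {..<i}"
  proof (intro equalityI subsetI)
    fix m assume m: "m \<in> {m \<in> A. m < ?xs ! i}"
    then obtain j where "j < card A" "m = ?xs ! j" using set len by (metis (no_types, lifting) CollectD in_set_conv_nth)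
    then show "m \<in> (\<lambda>j. ?xs ! j) ` {..<i}" using less m by auto
  next
    fix m assume "m \<in> (\<lambda>j. ?xs ! j) ` {..<i}"
    then obtain j where j: "j < i" "m = ?xs ! j" by auto
    then have "m \<in> A" using i len set nth_mem[of j ?xs] by auto
    then show "m \<in> {m \<in> A. m < ?xs ! i}" using less[of j] j i by auto
  qed
  moreover have "inj_on (\<lambda>j. ?xs ! j) {..<i}"
    using i len by (auto simp: inj_on_def nth_eq_iff_index_eq)
  ultimately show ?thesis by (simp add: card_image)
qed

text \<open>Keeping the index sets as arguments makes a minor the same expression with one element
  deleted from each set.\<close>

definition indexed_det :: "(nat \<Rightarrow> nat \<Rightarrow> real) \<Rightarrow> nat set \<Rightarrow> nat set \<Rightarrow> real" where
  "indexed_det e P M = Determinant.det (Matrix.mat (card P) (card M)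
     (\<lambda>(i, j). e (sorted_list_of_set P ! i) (sorted_list_of_set M ! j)))"

lemma indexed_det_transpose:
  assumes "card P = card M"
  shows "indexed_det e P M = indexed_det (\<lambda>k l. e l k) M P"
proof -
  let ?A = "Matrix.mat (card P) (card M) (\<lambda>(i, j). e (sorted_list_of_set P ! i) (sorted_list_of_set M ! j))"
  have "Determinant.det (transpose_mat ?A) = Determinant.det ?A"
    by (rule det_transpose[of _ "card M"]) (simp add: assms)
  moreover have "transpose_mat ?A =
    Matrix.mat (card M) (card P) (\<lambda>(i, j). e (sorted_list_of_set P ! j) (sorted_list_of_set M ! i))"
    by (rule eq_matI) auto
  ultimately show ?thesis by (simp add: indexed_det_def)
qed

text \<open>Laplace expansion along row 0, which belongs to \<open>Min P\<close>; the position of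
  column \<open>j\<close> is the number of smaller elements of \<open>M\<close>.\<close>

lemma indexed_det_row_expansion:
  assumes fin: "finite P" "finite M" and card: "card P = card M" and ne: "P \<noteq> {}"
  shows "indexed_det e P M =
    (\<Sum>j\<in>M. (-1) ^ card {k \<in> M. k < j} * e (Min P) j * indexed_det e (P - {Min P}) (M - {j}))"
proof -
  let ?p = "sorted_list_of_set P" and ?q = "sorted_list_of_set M"
  let ?A = "Matrix.mat (card P) (card M) (\<lambda>(i, j). e (?p ! i) (?q ! j))"
  have n: "0 < card P" using fin ne by (simp add: card_gt_0_iff)
  have p0: "?p ! 0 = Min P" using fin ne by (simp add: sorted_list_of_set_nonempty)
  have minor: "Determinant.det (mat_delete ?A 0 j) = indexed_det e (P - {Min P}) (M - {?q ! j})"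
    if j: "j < card M" for j
  proof -
    have "?q ! j \<in> M" using j fin by (metis length_sorted_list_of_set nth_mem set_sorted_list_of_set)
    then have cards: "card (P - {Min P}) = card P - 1" "card (M - {?q ! j}) = card M - 1"
      using fin ne by auto
    have "mat_delete ?A 0 j = Matrix.mat (card P - 1) (card M - 1)
       (\<lambda>(i, k). e (sorted_list_of_set (P - {Min P}) ! i) (sorted_list_of_set (M - {?q ! j}) ! k))"
      unfolding mat_delete_def
      by (rule eq_matI)
        (use sorted_list_of_set_Diff_nth[OF fin(1) n, unfolded p0] sorted_list_of_set_Diff_nth[OF fin(2) j]
          card in auto)
    then show ?thesis by (simp add: indexed_det_def cards)
  qed
  have "indexed_det e P M = (\<Sum>j<card M. ?A $$ (0, j) * cofactor ?A 0 j)"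
    unfolding indexed_det_def using n card by (intro laplace_expansion_row) auto
  also have "\<dots> = (\<Sum>j<card M. (-1) ^ card {k \<in> M. k < ?q ! j} * e (Min P) (?q ! j) *
      indexed_det e (P - {Min P}) (M - {?q ! j}))"
    using n minor card_less_sorted_list_of_set_nth[OF fin(2)]
    by (intro sum.cong) (auto simp: cofactor_def p0)
  also have "\<dots> = (\<Sum>j\<in>M. (-1) ^ card {k \<in> M. k < j} * e (Min P) j * indexed_det e (P - {Min P}) (M - {j}))"
  proof (rule sum.reindex_bij_betw)
    have "bij_betw ((!) ?q) {..<length ?q} (set ?q)" by (intro bij_betw_nth) auto
    then show "bij_betw ((!) ?q) {..<card M} M" using fin by simp
  qed
  finally show ?thesis .
qed

text \<open>Every term of the Leibniz formula meets each row and each column exactly once.\<close>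

lemma indexed_det_scale:
  assumes "finite P" "finite M" "card P = card M"
  shows "indexed_det (\<lambda>k l. x k * y l * e k l) P M = prod x P * prod y M * indexed_det e P M"
proof -
  let ?n = "card P"
  let ?p = "sorted_list_of_set P" and ?q = "sorted_list_of_set M"
  have less: "\<pi> i < card M" if "\<pi> permutes {0..<card M}" "i < card M" for \<pi> i
    using permutes_in_image[OF that(1), of i] that(2) by simp
  have px: "(\<Prod>i = 0..<?n. x (?p ! i)) = prod x P"
    using assms by (intro prod.reindex_bij_betw[where h = "(!) ?p"]) (simp add: bij_betw_nth atLeast0LessThan)
  have bq: "bij_betw ((!) ?q) {0..<?n} M" using assms by (simp add: bij_betw_nth atLeast0LessThan)
  have "indexed_det (\<lambda>k l. x k * y l * e k l) P M =
    (\<Sum>\<pi> | \<pi> permutes {0..<?n}. signof \<pi> * (\<Prod>i = 0..<?n. x (?p ! i) * y (?q ! \<pi> i) * e (?p ! i) (?q ! \<pi> i)))"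
    unfolding indexed_det_def
    by (subst det_def'[of _ ?n])
      (use assms(3) in \<open>auto intro!: sum.cong prod.cong simp: less\<close>)
  also have "\<dots> = (\<Sum>\<pi> | \<pi> permutes {0..<?n}. prod x P * prod y M *
      (signof \<pi> * (\<Prod>i = 0..<?n. e (?p ! i) (?q ! \<pi> i))))"
  proof (rule sum.cong[OF refl])
    fix \<pi> assume "\<pi> \<in> {\<pi>. \<pi> permutes {0..<?n}}"
    then have \<pi>: "bij_betw \<pi> {0..<?n} {0..<?n}" by (simp add: permutes_imp_bij)
    have "(\<Prod>i = 0..<?n. y (?q ! \<pi> i)) = prod y M"
      using bij_betw_trans[OF \<pi> bq] prod.reindex_bij_betw[of "(!) ?q \<circ> \<pi>" "{0..<?n}" M y] by simp
    then show "signof \<pi> * (\<Prod>i = 0..<?n. x (?p ! i) * y (?q ! \<pi> i) * e (?p ! i) (?q ! \<pi> i)) =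
      prod x P * prod y M * (signof \<pi> * (\<Prod>i = 0..<?n. e (?p ! i) (?q ! \<pi> i)))"
      by (simp add: prod.distrib px)
  qed
  also have "\<dots> = prod x P * prod y M *
      (\<Sum>\<pi> | \<pi> permutes {0..<?n}. signof \<pi> * (\<Prod>i = 0..<?n. e (?p ! i) (?q ! \<pi> i)))"
    by (simp add: sum_distrib_left)
  also have "(\<Sum>\<pi> | \<pi> permutes {0..<?n}. signof \<pi> * (\<Prod>i = 0..<?n. e (?p ! i) (?q ! \<pi> i))) = indexed_det e P M"
    unfolding indexed_det_def
    by (subst det_def'[of _ ?n])
      (use assms(3) in \<open>auto intro!: sum.cong prod.cong simp: less\<close>)
  finally show ?thesis .
qed

lemma indexed_det_cong:
  assumes "finite P" "finite M" "\<And>k l. k \<in> P \<Longrightarrow> l \<in> M \<Longrightarrow> e k l = e' k l"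
  shows "indexed_det e P M = indexed_det e' P M"
proof -
  have "sorted_list_of_set P ! i \<in> P" if "i < card P" for i
    using that assms(1) by (metis length_sorted_list_of_set nth_mem set_sorted_list_of_set)
  moreover have "sorted_list_of_set M ! i \<in> M" if "i < card M" for i
    using that assms(2) by (metis length_sorted_list_of_set nth_mem set_sorted_list_of_set)
  ultimately show ?thesis
    using assms(3) unfolding indexed_det_def by (intro arg_cong[where f = Determinant.det] eq_matI) auto
qed

section \<open>Expansion of the source-sink determinant along the smallest index\<close>

text \<open>The signs count the sources in the current \<open>P\<close>. Deleting a source can
  therefore change the remaining entries, which the recursions below have to account for.\<close>

definition K_det :: "(nat \<Rightarrow> nat \<Rightarrow> real) \<Rightarrow> nat set \<Rightarrow> nat set \<Rightarrow> real" where
  "K_det a P M = indexed_det (\<lambda>k l. (-1) ^ sources_between P k l * a k l) P M"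

text \<open>In the expansion along the row of \<open>m\<close>, the Laplace sign counts the sinks
  below \<open>j\<close> and the entry counts the sources between \<open>m\<close> and
  \<open>j\<close>. Together they count all indices between, as in a Pfaffian expansion.\<close>

lemma K_det_recursion_source:
  assumes fin: "finite P" "finite M" and disj: "P \<inter> M = {}" and card: "card P = card M"
    and m: "m = Min (P \<union> M)" "m \<in> P"
  shows "K_det a P M = (\<Sum>j\<in>M. (-1) ^ card ((P \<union> M) \<inter> {m<..<j}) * a m j * K_det a (P - {m}) (M - {j}))"
proof -
  have le: "m \<le> i" if "i \<in> P \<union> M" for i using that fin m by simp
  have lt: "m < i" if "i \<in> P \<union> M" "i \<noteq> m" for i using le[OF that(1)] that(2) by simp
  have lt': "m < i" if "i \<in> M" for i using lt[of i] that m(2) disj by blast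
  have P: "P \<noteq> {}" "Min P = m"
    using m le fin by (auto intro: Min_eqI)
  let ?e = "\<lambda>k l. (-1) ^ sources_between P k l * a k l"
  have term_eq: "(-1) ^ card {k \<in> M. k < j} * ?e m j * indexed_det ?e (P - {m}) (M - {j}) =
      (-1) ^ card ((P \<union> M) \<inter> {m<..<j}) * a m j * K_det a (P - {m}) (M - {j})" if j: "j \<in> M" for j
  proof -
    have mj: "m < j" using lt'[OF j] .
    have "(P \<union> M) \<inter> {m<..<j} = {k \<in> M. k < j} \<union> {k \<in> P. m < k \<and> k < j}"
      using lt' by auto
    moreover have "card \<dots> = card {k \<in> M. k < j} + card {k \<in> P. m < k \<and> k < j}"
      using fin disj by (intro card_Un_disjoint) auto
    moreover have "sources_between P m j = card {k \<in> P. m < k \<and> k < j}"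
      using mj by (simp add: sources_between_def)
    moreover have "indexed_det ?e (P - {m}) (M - {j}) = K_det a (P - {m}) (M - {j})"
      unfolding K_det_def
    proof (rule indexed_det_cong)
      \<comment> \<open>The smallest source is never strictly between two indices, so deleting it
        leaves the signs of the minor unchanged.\<close>
      fix k l assume "k \<in> P - {m}" "l \<in> M - {j}"
      then have "m \<le> min k l" using le by auto
      then have "{i \<in> P. min k l < i \<and> i < max k l} = {i \<in> P - {m}. min k l < i \<and> i < max k l}"
        by auto
      then show "?e k l = (-1) ^ sources_between (P - {m}) k l * a k l"
        by (simp add: sources_between_def)
    qed (use fin in auto)
    ultimately show ?thesis by (simp add: power_add)
  qed
  have "K_det a P M = (\<Sum>j\<in>M. (-1) ^ card {k \<in> M. k < j} * ?e m j * indexed_det ?e (P - {m}) (M - {j}))"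
    unfolding K_det_def using indexed_det_row_expansion[OF fin card P(1), of ?e] by (simp add: P(2))
  also have "\<dots> = (\<Sum>j\<in>M. (-1) ^ card ((P \<union> M) \<inter> {m<..<j}) * a m j * K_det a (P - {m}) (M - {j}))"
    by (rule sum.cong[OF refl term_eq])
  finally show ?thesis .
qed

text \<open>When a source \<open>j\<close> is deleted, \<open>s(u, v)\<close> drops by one exactly if \<open>j\<close> separates \<open>u\<close> from
  \<open>v\<close>. The resulting sign factors into a row sign and a column sign.\<close>

lemma K_det_recursion_sink:
  assumes fin: "finite P" "finite M" and disj: "P \<inter> M = {}" and card: "card P = card M"
    and m: "m = Min (P \<union> M)" "m \<in> M" and sym: "\<And>k l. a k l = a l k"
  shows "K_det a P M = (\<Sum>j\<in>P. (-1) ^ card ((P \<union> M) \<inter> {m<..<j}) * a m j * K_det a (P - {j}) (M - {m}))"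
proof -
  have le: "m \<le> i" if "i \<in> P \<union> M" for i using that fin m by simp
  have lt: "m < i" if "i \<in> P \<union> M" "i \<noteq> m" for i using le[OF that(1)] that(2) by simp
  have lt': "m < i" if "i \<in> P" for i using lt[of i] that m(2) disj by blast
  have M: "M \<noteq> {}" "Min M = m"
    using m le fin by (auto intro: Min_eqI)
  let ?e = "\<lambda>k l. (-1) ^ sources_between P k l * a k l"
  have term_eq: "(-1) ^ card {k \<in> P. k < j} * ?e j m * indexed_det ?e (P - {j}) (M - {m}) =
      (-1) ^ card ((P \<union> M) \<inter> {m<..<j}) * a m j * K_det a (P - {j}) (M - {m})" if j: "j \<in> P" for j
  proof -
    have mj: "m < j" using lt'[OF j] .
    \<comment> \<open>For \<open>k\<close> and \<open>l\<close> different from \<open>j\<close>, the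
      product \<open>x k * x l\<close> is \<open>-1\<close> exactly if \<open>j\<close> separates
      them.\<close>
    define x where "x = (\<lambda>k. if k < j then -1 else 1 :: real)"
    have prod_x: "prod x A = (-1) ^ card {k \<in> A. k < j}" if "finite A" for A
      unfolding x_def using prod.inter_filter[OF that, of "\<lambda>_. -1 :: real" "\<lambda>k. k < j"] by simp
    have "indexed_det ?e (P - {j}) (M - {m}) =
      indexed_det (\<lambda>k l. x k * x l * ((-1) ^ sources_between (P - {j}) k l * a k l)) (P - {j}) (M - {m})"
    proof (rule indexed_det_cong)
      fix k l assume kl: "k \<in> P - {j}" "l \<in> M - {m}"
      then have ne: "k \<noteq> j" "l \<noteq> j" using j disj by auto
      have "(-1 :: real) ^ sources_between P k l = x k * x l * (-1) ^ sources_between (P - {j}) k l"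
      proof (cases "min k l < j \<and> j < max k l")
        case True
        then have "{i \<in> P. min k l < i \<and> i < max k l} = insert j {i \<in> P - {j}. min k l < i \<and> i < max k l}"
          using j by auto
        then have "sources_between P k l = Suc (sources_between (P - {j}) k l)"
          using fin by (simp add: sources_between_def)
        moreover have "x k * x l = -1" using True ne by (auto simp: x_def min_def max_def split: if_splits)
        ultimately show ?thesis by simp
      next
        case False
        then have "{i \<in> P. min k l < i \<and> i < max k l} = {i \<in> P - {j}. min k l < i \<and> i < max k l}"
          by auto
        moreover have "x k * x l = 1" using False ne by (auto simp: x_def min_def max_def split: if_splits)
        ultimately show ?thesis by (simp add: sources_between_def)
      qed
      then show "?e k l = x k * x l * ((-1) ^ sources_between (P - {j}) k l * a k l)" by simp
    qed (use fin in auto)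
    also have "\<dots> = prod x (P - {j}) * prod x (M - {m}) * K_det a (P - {j}) (M - {m})"
      unfolding K_det_def using fin card j m by (intro indexed_det_scale) auto
    also have "prod x (P - {j}) = (-1) ^ card {k \<in> P. k < j}"
    proof -
      have "{k \<in> P - {j}. k < j} = {k \<in> P. k < j}" by auto
      then show ?thesis using prod_x[of "P - {j}"] fin by simp
    qed
    also have "prod x (M - {m}) = (-1) ^ card {k \<in> M. m < k \<and> k < j}"
    proof -
      have "{k \<in> M - {m}. k < j} = {k \<in> M. m < k \<and> k < j}" using lt by auto
      then show ?thesis using prod_x[of "M - {m}"] fin by simp
    qed
    finally have det: "indexed_det ?e (P - {j}) (M - {m}) = (-1) ^ card {k \<in> P. k < j} *
      (-1) ^ card {k \<in> M. m < k \<and> k < j} * K_det a (P - {j}) (M - {m})" .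
    have "{k \<in> P. m < k \<and> k < j} = {k \<in> P. k < j}" using lt' by auto
    then have sb: "sources_between P j m = card {k \<in> P. k < j}"
      using mj by (simp add: sources_between_def)
    have "(P \<union> M) \<inter> {m<..<j} = {k \<in> P. k < j} \<union> {k \<in> M. m < k \<and> k < j}"
      using lt' by auto
    moreover have "card \<dots> = card {k \<in> P. k < j} + card {k \<in> M. m < k \<and> k < j}"
      using fin disj by (intro card_Un_disjoint) auto
    ultimately show ?thesis
      unfolding det sb using sym[of j m] by (simp add: power_add)
  qed
  \<comment> \<open>The smallest index now belongs to a column, so the row expansion is applied to
    the transpose.\<close>
  have "K_det a P M = (\<Sum>j\<in>P. (-1) ^ card {k \<in> P. k < j} * ?e j m * indexed_det ?e (P - {j}) (M - {m}))"
  proof -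
    have "indexed_det (\<lambda>k l. ?e l k) M P = (\<Sum>j\<in>P. (-1) ^ card {k \<in> P. k < j} * ?e j m *
        indexed_det (\<lambda>k l. ?e l k) (M - {m}) (P - {j}))"
      using indexed_det_row_expansion[OF fin(2,1) card[symmetric] M(1), of "\<lambda>k l. ?e l k"] by (simp add: M(2))
    moreover have "indexed_det (\<lambda>k l. ?e l k) (M - {m}) (P - {j}) = indexed_det ?e (P - {j}) (M - {m})"
      if "j \<in> P" for j
      using indexed_det_transpose[of "P - {j}" "M - {m}" ?e] that m fin card by simp
    ultimately show ?thesis
      unfolding K_det_def by (subst indexed_det_transpose[OF card]) (simp cong: sum.cong)
  qed
  also have "\<dots> = (\<Sum>j\<in>P. (-1) ^ card ((P \<union> M) \<inter> {m<..<j}) * a m j * K_det a (P - {j}) (M - {m}))"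
    by (rule sum.cong[OF refl term_eq])
  finally show ?thesis .
qed

section \<open>From the two-replica sum to the determinant\<close>

text \<open>Both sides satisfy the same recursion along the smallest index. The factor
  \<open>1 - d m * d j\<close> is 2 for one source and one sink and 0 otherwise, so each step
  removes one index of each kind and yields a factor 2. Unequal numbers of sources and sinks stay
  unequal down to an empty sum.\<close>

lemma two_replica_sum_eq_det:
  fixes c :: "nat set \<Rightarrow> real" and a :: "nat \<Rightarrow> nat \<Rightarrow> real"
  assumes "finite S"
    and c0: "c {} = 1"
    and pf: "\<And>T. T \<subseteq> S \<Longrightarrow> T \<noteq> {} \<Longrightarrow>
      c T = (\<Sum>j\<in>T - {Min T}. (-1) ^ card (T \<inter> {Min T<..<j}) * a (Min T) j * c (T - {Min T, j}))"
    and sym: "\<And>k l. a k l = a l k"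
  shows "two_replica_sum (\<lambda>i. if Q i then -1 else 1) c S =
    (if card {i \<in> S. Q i} = card {i \<in> S. \<not> Q i}
     then 2 ^ card {i \<in> S. Q i} * K_det a {i \<in> S. Q i} {i \<in> S. \<not> Q i} else 0)"
  using assms(1) pf
proof (induction "card S" arbitrary: S rule: less_induct)
  case less
  define d where "d = (\<lambda>i. if Q i then -1 else 1 :: real)"
  note fin = less.prems(1) and pf = less.prems(2)
  show ?case
  proof (cases "S = {}")
    case True
    \<comment> \<open>The only splitting contributes \<open>c {} * c {} = 1\<close>, and the
      determinant of dimension 0 is also 1.\<close>
    then show ?thesis by (simp add: two_replica_sum_def c0 K_det_def indexed_det_def det_dim_zero)
  next
    case False
    define m where "m = Min S"
    have mS: "m \<in> S" using fin False by (simp add: m_def)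
    define P M where "P = {i \<in> S. Q i}" and "M = {i \<in> S. \<not> Q i}"
    have PM: "finite P" "finite M" "P \<inter> M = {}" "P \<union> M = S" using fin by (auto simp: P_def M_def)
    \<comment> \<open>The possible partners of \<open>m\<close>: sinks if \<open>m\<close> is a
      source, and sources if \<open>m\<close> is a sink.\<close>
    define N where "N = (if Q m then M else P)"
    have N: "N \<subseteq> S - {m}" using mS by (auto simp: N_def P_def M_def)
    let ?s = "\<lambda>j. (-1 :: real) ^ card (S \<inter> {m<..<j})"
    have "two_replica_sum d c S =
      (\<Sum>j\<in>S - {m}. (1 - d m * d j) * ?s j * a m j * two_replica_sum d c (S - {m, j}))"
    proof (rule two_replica_sum_recursion[OF fin False m_def])
      fix T assume T: "T \<subseteq> S" "m \<in> T"
      then have "finite T" using fin by (auto intro: finite_subset)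
      then have "Min T = m" using T fin by (intro Min_eqI) (auto simp: m_def)
      then show "c T = (\<Sum>j\<in>T - {m}. (-1) ^ card (T \<inter> {m<..<j}) * a m j * c (T - {m, j}))"
        using pf[OF T(1)] T by auto
    qed
    also have "\<dots> = (\<Sum>j\<in>N. 2 * (?s j * a m j * two_replica_sum d c (S - {m, j})))"
      by (rule sum.mono_neutral_cong_right)
        (use fin N in \<open>auto simp: N_def P_def M_def d_def split: if_splits\<close>)
    also have "\<dots> = (\<Sum>j\<in>N. 2 * (?s j * a m j * (if card P = card M then
       2 ^ (card P - 1) * K_det a (P - {m, j}) (M - {m, j}) else 0)))"
    proof (rule sum.cong[OF refl])
      fix j assume j: "j \<in> N"
      let ?S = "S - {m, j}"
      have PM': "{i \<in> ?S. Q i} = P - {m, j}" "{i \<in> ?S. \<not> Q i} = M - {m, j}"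
        by (auto simp: P_def M_def)
      \<comment> \<open>Positivity makes the truncated subtractions exact, so the numbers of sources
        and sinks agree after the removal iff they agreed before.\<close>
      have cards: "card (P - {m, j}) = card P - 1" "card (M - {m, j}) = card M - 1" "card P > 0" "card M > 0"
      proof -
        have "P - {m, j} = P - {if Q m then m else j}" "M - {m, j} = M - {if Q m then j else m}"
          "(if Q m then m else j) \<in> P" "(if Q m then j else m) \<in> M"
          using j mS by (auto simp: N_def P_def M_def split: if_splits)
        then show "card (P - {m, j}) = card P - 1" "card (M - {m, j}) = card M - 1" "card P > 0" "card M > 0"
          using PM by (auto simp: card_gt_0_iff simp del: Diff_insert)
      qed
      have "two_replica_sum d c ?S = (if card {i \<in> ?S. Q i} = card {i \<in> ?S. \<not> Q i}
        then 2 ^ card {i \<in> ?S. Q i} * K_det a {i \<in> ?S. Q i} {i \<in> ?S. \<not> Q i} else 0)"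
        unfolding d_def
      proof (rule less.hyps)
        show "card ?S < card S" using fin mS by (intro psubset_card_mono) auto
      qed (use fin pf in auto)
      then have "two_replica_sum d c ?S = (if card P = card M then
         2 ^ (card P - 1) * K_det a (P - {m, j}) (M - {m, j}) else 0)"
        using cards unfolding PM' by auto
      then show "2 * (?s j * a m j * two_replica_sum d c ?S) = 2 * (?s j * a m j * (if card P = card M then
         2 ^ (card P - 1) * K_det a (P - {m, j}) (M - {m, j}) else 0))" by simp
    qed
    also have "\<dots> = (if card P = card M then 2 ^ card P * K_det a P M else 0)"
    proof (cases "card P = card M")
      case True
      have "(\<Sum>j\<in>N. ?s j * a m j * K_det a (P - {m, j}) (M - {m, j})) = K_det a P M"
      proof (cases "Q m")
        case Q: True
        have "K_det a P M = (\<Sum>j\<in>M. ?s j * a m j * K_det a (P - {m}) (M - {j}))"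
          using K_det_recursion_source[OF PM(1-3) True, of m a] Q mS PM(4) by (simp add: m_def P_def)
        also have "\<dots> = (\<Sum>j\<in>N. ?s j * a m j * K_det a (P - {m, j}) (M - {m, j}))"
        proof (rule sum.cong)
          fix j assume "j \<in> N"
          then have "P - {m, j} = P - {m}" "M - {m, j} = M - {j}"
            using Q by (auto simp: N_def P_def M_def)
          then show "?s j * a m j * K_det a (P - {m}) (M - {j}) =
            ?s j * a m j * K_det a (P - {m, j}) (M - {m, j})" by simp
        qed (use Q in \<open>simp add: N_def\<close>)
        finally show ?thesis by simp
      next
        case Q: False
        have "K_det a P M = (\<Sum>j\<in>P. ?s j * a m j * K_det a (P - {j}) (M - {m}))"
          using K_det_recursion_sink[OF PM(1-3) True, of m a] Q mS PM(4) sym by (simp add: m_def M_def)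
        also have "\<dots> = (\<Sum>j\<in>N. ?s j * a m j * K_det a (P - {m, j}) (M - {m, j}))"
        proof (rule sum.cong)
          fix j assume "j \<in> N"
          then have "P - {m, j} = P - {j}" "M - {m, j} = M - {m}"
            using Q by (auto simp: N_def P_def M_def)
          then show "?s j * a m j * K_det a (P - {j}) (M - {m}) =
            ?s j * a m j * K_det a (P - {m, j}) (M - {m, j})" by simp
        qed (use Q in \<open>simp add: N_def\<close>)
        finally show ?thesis by simp
      qed
      moreover have "card P > 0"
        using True mS PM by (auto simp: card_gt_0_iff)
      then have "2 ^ card P = (2 :: real) * 2 ^ (card P - 1)" by (simp add: power_eq_if)
      moreover have "(\<Sum>j\<in>N. 2 * (?s j * a m j * (2 ^ (card P - 1) * K_det a (P - {m, j}) (M - {m, j})))) =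
        2 * 2 ^ (card P - 1) * (\<Sum>j\<in>N. ?s j * a m j * K_det a (P - {m, j}) (M - {m, j}))"
        by (simp add: sum_distrib_left algebra_simps)
      ultimately show ?thesis using True by simp
    qed simp
    finally show ?thesis unfolding d_def P_def M_def .
  qed
qed

section \<open>Ising correlations on the boundary\<close>

definition ising_weight :: "'a set set \<Rightarrow> ('a set \<Rightarrow> real) \<Rightarrow> ('a \<Rightarrow> real) \<Rightarrow> real" where
  "ising_weight E J \<sigma> = (\<Prod>e\<in>E. exp (J e * (\<Prod>x\<in>e. \<sigma> x)))"

definition ising_partition :: "'a set \<Rightarrow> 'a set set \<Rightarrow> ('a set \<Rightarrow> real) \<Rightarrow> real" where
  "ising_partition V E J = (\<Sum>\<sigma>\<in>spin_configs V. ising_weight E J \<sigma>)"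

text \<open>The product runs over indices rather than vertices, so the spin of a doubled vertex can
  occur twice.\<close>

definition ising_corr ::
    "'a set \<Rightarrow> 'a set set \<Rightarrow> ('a set \<Rightarrow> real) \<Rightarrow> ('i \<Rightarrow> 'a) \<Rightarrow> 'i set \<Rightarrow> real" where
  "ising_corr V E J v S =
     (\<Sum>\<sigma>\<in>spin_configs V. (\<Prod>i\<in>S. \<sigma> (v i)) * ising_weight E J \<sigma>) / ising_partition V E J"

text \<open>Here \<open>x = y\<close> is allowed, as happens for the two copies of a doubled
  vertex.\<close>

definition ising_pair :: "'a set \<Rightarrow> 'a set set \<Rightarrow> ('a set \<Rightarrow> real) \<Rightarrow> 'a \<Rightarrow> 'a \<Rightarrow> real" where
  "ising_pair V E J x y =
     (\<Sum>\<sigma>\<in>spin_configs V. \<sigma> x * \<sigma> y * ising_weight E J \<sigma>) / ising_partition V E J"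

lemma finite_spin_configs: "finite V \<Longrightarrow> finite (spin_configs V)"
  by (simp add: spin_configs_def finite_PiE)

lemma spin_cases: "\<sigma> \<in> spin_configs V \<Longrightarrow> x \<in> V \<Longrightarrow> \<sigma> x = 1 \<or> \<sigma> x = -1"
  by (auto simp: spin_configs_def PiE_def Pi_def)

lemma spin_square: "\<sigma> \<in> spin_configs V \<Longrightarrow> x \<in> V \<Longrightarrow> \<sigma> x * \<sigma> x = 1"
  using spin_cases by fastforce

lemma spin_square_left: "\<sigma> \<in> spin_configs V \<Longrightarrow> x \<in> V \<Longrightarrow> \<sigma> x * (\<sigma> x * y) = y"
  by (simp add: spin_square flip: mult.assoc)

lemma spin_configs_restrict:
  "(\<And>x. x \<in> V \<Longrightarrow> f x = 1 \<or> f x = -1) \<Longrightarrow> restrict f V \<in> spin_configs V"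
  by (auto simp: spin_configs_def PiE_def Pi_def)

lemma spin_configs_eqI:
  "\<sigma> \<in> spin_configs V \<Longrightarrow> (\<And>x. x \<in> V \<Longrightarrow> f x = \<sigma> x) \<Longrightarrow> restrict f V = \<sigma>"
  by (auto simp: spin_configs_def PiE_def extensional_def restrict_def)

lemma ising_partition_pos: "finite V \<Longrightarrow> ising_partition V E J > 0"
proof -
  assume V: "finite V"
  have "(\<lambda>x\<in>V. 1) \<in> spin_configs V" by (rule spin_configs_restrict) simp
  then show ?thesis
    unfolding ising_partition_def using finite_spin_configs[OF V]
    by (intro sum_pos) (auto simp: ising_weight_def intro!: prod_pos)
qed

lemma AT_expect_ising:
  assumes V: "finite V" and U0: "\<forall>e\<in>E. U e = 0"
  shows "AT_expect V E J U f =
    (\<Sum>\<sigma>\<in>spin_configs V. \<Sum>\<tau>\<in>spin_configs V. f \<sigma> \<tau> * (ising_weight E J \<sigma> * ising_weight E J \<tau>)) /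
      (ising_partition V E J * ising_partition V E J)"
proof -
  have w: "AT_weight E J U \<sigma> \<tau> = ising_weight E J \<sigma> * ising_weight E J \<tau>" for \<sigma> \<tau>
    unfolding AT_weight_def ising_weight_def prod.distrib[symmetric]
    using U0 by (intro prod.cong) (auto simp: distrib_left exp_add)
  have Z: "AT_partition V E J U = ising_partition V E J * ising_partition V E J"
    by (simp add: AT_partition_def ising_partition_def w sum_product)
  show ?thesis
    unfolding AT_expect_def AT_prob_def Z w by (simp add: sum_divide_distrib mult.commute)
qed

lemma AT_expect_ising_product:
  assumes "finite V" "\<forall>e\<in>E. U e = 0"
  shows "AT_expect V E J U (\<lambda>\<sigma> \<tau>. f \<sigma> * g \<tau>) =
    (\<Sum>\<sigma>\<in>spin_configs V. f \<sigma> * ising_weight E J \<sigma>) / ising_partition V E J *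
    ((\<Sum>\<tau>\<in>spin_configs V. g \<tau> * ising_weight E J \<tau>) / ising_partition V E J)"
proof -
  have "(\<Sum>\<sigma>\<in>spin_configs V. \<Sum>\<tau>\<in>spin_configs V. f \<sigma> * g \<tau> * (ising_weight E J \<sigma> * ising_weight E J \<tau>)) =
    (\<Sum>\<sigma>\<in>spin_configs V. f \<sigma> * ising_weight E J \<sigma>) * (\<Sum>\<tau>\<in>spin_configs V. g \<tau> * ising_weight E J \<tau>)"
    unfolding sum_product by (intro sum.cong) (auto simp: algebra_simps)
  then show ?thesis by (simp add: AT_expect_ising[OF assms])
qed

section \<open>The ratio of the replicas and the Pfaffian recursion\<close>

text \<open>For fixed \<tau>, multiplication by \<tau> is an involution of the spin
  configurations.\<close>

lemma sum_spin_ratio: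
  fixes f :: "('a \<Rightarrow> real) \<Rightarrow> ('a \<Rightarrow> real) \<Rightarrow> real"
  shows "(\<Sum>\<sigma>\<in>spin_configs V. \<Sum>\<tau>\<in>spin_configs V. f \<sigma> \<tau>) =
    (\<Sum>\<rho>\<in>spin_configs V. \<Sum>\<tau>\<in>spin_configs V. f (\<lambda>x\<in>V. \<rho> x * \<tau> x) \<tau>)"
proof -
  have "(\<Sum>\<sigma>\<in>spin_configs V. f \<sigma> \<tau>) = (\<Sum>\<rho>\<in>spin_configs V. f (\<lambda>x\<in>V. \<rho> x * \<tau> x) \<tau>)"
    if \<tau>: "\<tau> \<in> spin_configs V" for \<tau>
  proof (rule sum.reindex_bij_witness[of _ "\<lambda>\<rho>. \<lambda>x\<in>V. \<rho> x * \<tau> x" "\<lambda>\<rho>. \<lambda>x\<in>V. \<rho> x * \<tau> x"])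
    fix \<sigma> assume \<sigma>: "\<sigma> \<in> spin_configs V"
    show inv: "(\<lambda>x\<in>V. (\<lambda>x\<in>V. \<sigma> x * \<tau> x) x * \<tau> x) = \<sigma>"
      by (rule spin_configs_eqI[OF \<sigma>]) (simp add: mult.assoc spin_square[OF \<tau>])
    then show "(\<lambda>x\<in>V. (\<lambda>x\<in>V. \<sigma> x * \<tau> x) x * \<tau> x) = \<sigma>" .
    show "(\<lambda>x\<in>V. \<sigma> x * \<tau> x) \<in> spin_configs V"
      by (rule spin_configs_restrict) (use spin_cases[OF \<sigma>] spin_cases[OF \<tau>] in fastforce)
    then show "(\<lambda>x\<in>V. \<sigma> x * \<tau> x) \<in> spin_configs V" .
    show "f (\<lambda>x\<in>V. (\<lambda>x\<in>V. \<sigma> x * \<tau> x) x * \<tau> x) \<tau> = f \<sigma> \<tau>" using inv by simp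
  qed
  then show ?thesis by (subst sum.swap, subst (2) sum.swap) (rule sum.cong[OF refl])
qed

lemma simple_graph_edgeE:
  assumes "finite_simple_graph V E" "e \<in> E"
  obtains x y where "e = {x, y}" "x \<noteq> y" "x \<in> V" "y \<in> V"
proof -
  have "card e = 2" "e \<subseteq> V" using assms by (auto simp: finite_simple_graph_def)
  then show ?thesis using that by (auto simp: card_2_iff)
qed

text \<open>For \<open>\<sigma> = \<rho>\<tau>\<close>, an edge on which \<open>\<rho>\<close> is not constant has weight \<open>1\<close>. Hence flipping \<open>\<tau>\<close> on a
  cluster of the remaining edges preserves the weight.\<close>

lemma odd_cluster_sum_zero:
  fixes v :: "'i \<Rightarrow> 'a"
  assumes G: "finite_simple_graph V E" and \<rho>: "\<rho> \<in> spin_configs V"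
    and T: "finite T" "v ` T \<subseteq> V"
    and H: "H = {e \<in> E. (\<Prod>x\<in>e. \<rho> x) = 1}"
    and odd: "odd (card {i \<in> T. v i \<in> C})" and C: "C = (adj H)\<^sup>* `` {u}"
  shows "(\<Sum>\<tau>\<in>spin_configs V. (\<Prod>i\<in>T. \<tau> (v i)) *
    (\<Prod>e\<in>E. exp (J e * ((\<Prod>x\<in>e. \<rho> x) * (\<Prod>x\<in>e. \<tau> x) + (\<Prod>x\<in>e. \<tau> x))))) = 0"
    (is "sum ?f _ = 0")
proof -
  define flip where "flip = (\<lambda>\<tau>. \<lambda>x\<in>V. (if x \<in> C then - \<tau> x else \<tau> x :: real))"
  have flip_eq: "flip \<tau> = (\<lambda>x\<in>V. (if x \<in> C then - \<tau> x else \<tau> x))" for \<tau>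
    by (simp add: flip_def)
  have flip_in: "flip \<tau> \<in> spin_configs V" if "\<tau> \<in> spin_configs V" for \<tau>
    unfolding flip_def by (rule spin_configs_restrict) (use spin_cases[OF that] in fastforce)
  have flip_flip: "flip (flip \<tau>) = \<tau>" if "\<tau> \<in> spin_configs V" for \<tau>
    unfolding flip_eq[of "flip \<tau>"] by (rule spin_configs_eqI[OF that]) (simp add: flip_def)
  have neg: "?f (flip \<tau>) = - ?f \<tau>" if \<tau>: "\<tau> \<in> spin_configs V" for \<tau>
  proof -
    have "(\<Prod>i\<in>T. flip \<tau> (v i)) = (\<Prod>i\<in>T. (if v i \<in> C then -1 else 1) * \<tau> (v i))"
      using T(2) by (intro prod.cong) (auto simp: flip_def)
    also have "\<dots> = (\<Prod>i\<in>T. if v i \<in> C then -1 else 1) * (\<Prod>i\<in>T. \<tau> (v i))"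
      by (rule prod.distrib)
    also have "(\<Prod>i\<in>T. if v i \<in> C then -1 else 1 :: real) = (\<Prod>i\<in>{i \<in> T. v i \<in> C}. -1)"
      by (rule prod.inter_filter[OF T(1), symmetric])
    also have "\<dots> = -1" using odd by simp
    finally have T_flip: "(\<Prod>i\<in>T. flip \<tau> (v i)) = - (\<Prod>i\<in>T. \<tau> (v i))" by simp
    have "(\<Prod>x\<in>e. \<rho> x) * (\<Prod>x\<in>e. flip \<tau> x) + (\<Prod>x\<in>e. flip \<tau> x) =
      (\<Prod>x\<in>e. \<rho> x) * (\<Prod>x\<in>e. \<tau> x) + (\<Prod>x\<in>e. \<tau> x)" if e: "e \<in> E" for e
    proof -
      obtain x y where xy: "e = {x, y}" "x \<noteq> y" "x \<in> V" "y \<in> V"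
        using simple_graph_edgeE[OF G e] .
      show ?thesis
      proof (cases "e \<in> H")
        case True
        then have "(x, y) \<in> adj H" "(y, x) \<in> adj H" using xy by (auto simp: adj_def insert_commute)
        then have "x \<in> C \<longleftrightarrow> y \<in> C" unfolding C by (auto intro: rtrancl_into_rtrancl)
        then show ?thesis using xy by (auto simp: flip_def)
      next
        case False
        then have "\<rho> x * \<rho> y \<noteq> 1" using e xy by (simp add: H)
        then have "\<rho> x * \<rho> y = -1" using spin_cases[OF \<rho> xy(3)] spin_cases[OF \<rho> xy(4)] by auto
        then show ?thesis using xy by simp
      qed
    qed
    then have "(\<Prod>e\<in>E. exp (J e * ((\<Prod>x\<in>e. \<rho> x) * (\<Prod>x\<in>e. flip \<tau> x) + (\<Prod>x\<in>e. flip \<tau> x)))) =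
      (\<Prod>e\<in>E. exp (J e * ((\<Prod>x\<in>e. \<rho> x) * (\<Prod>x\<in>e. \<tau> x) + (\<Prod>x\<in>e. \<tau> x))))"
      by (intro prod.cong) auto
    then show ?thesis using T_flip by simp
  qed
  have "sum ?f (spin_configs V) = (\<Sum>\<tau>\<in>spin_configs V. ?f (flip \<tau>))"
    by (rule sum.reindex_bij_witness[of _ flip flip]) (auto simp: flip_in flip_flip)
  also have "\<dots> = - sum ?f (spin_configs V)"
    unfolding sum_negf[symmetric] by (rule sum.cong[OF refl neg])
  finally show ?thesis by simp
qed

lemma cluster_spin_const:
  assumes G: "finite_simple_graph V E" and \<rho>: "\<rho> \<in> spin_configs V"
    and H: "H = {e \<in> E. (\<Prod>x\<in>e. \<rho> x) = 1}" and xy: "(x, y) \<in> (adj H)\<^sup>*"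
  shows "\<rho> x = \<rho> y"
  using xy
proof (induction rule: rtrancl_induct)
  case (step y z)
  then have e: "{y, z} \<in> E" and p: "(\<Prod>x\<in>{y, z}. \<rho> x) = 1" by (auto simp: adj_def H)
  have "y \<noteq> z" "y \<in> V" "z \<in> V" using G e by (auto simp: finite_simple_graph_def)
  then show ?case using p spin_cases[OF \<rho>, of y] spin_cases[OF \<rho>, of z] step.IH by auto
qed simp

text \<open>This is the Pfaffian recursion before normalization: the factors
  \<open>\<tau> (v m) * \<tau> (v j)\<close> remove \<open>m\<close> and \<open>j\<close> from the
  correlation in the second replica, while the first replica carries their two-point function. In
  terms of \<rho> the vanishing holds for each \<rho> separately.\<close>

lemma ising_alternating_sum:
  fixes v :: "nat \<Rightarrow> 'a"
  assumes G: "finite_simple_graph V E"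
    and nc: "\<And>H. H \<subseteq> E \<Longrightarrow> noncrossing T (\<lambda>i. (adj H)\<^sup>* `` {v i})"
    and T: "finite T" "v ` T \<subseteq> V" and m: "m \<in> T"
  shows "(\<Sum>j\<in>T. (-1) ^ card (T \<inter> {..<j}) *
    (\<Sum>\<sigma>\<in>spin_configs V. \<Sum>\<tau>\<in>spin_configs V. \<sigma> (v m) * \<sigma> (v j) * (\<tau> (v m) * \<tau> (v j) * (\<Prod>i\<in>T. \<tau> (v i))) *
      (ising_weight E J \<sigma> * ising_weight E J \<tau>))) = 0"
proof -
  let ?\<Omega> = "spin_configs V"
  let ?s = "\<lambda>j. (-1 :: real) ^ card (T \<inter> {..<j})"
  \<comment> \<open>The part of the observable that depends on \<rho> alone; what remains for the
    sum over \<tau> is the product over \<open>T\<close> and the weight.\<close>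
  define h where "h = (\<lambda>\<rho>. \<rho> (v m) * (\<Sum>j\<in>T. ?s j * \<rho> (v j)) :: real)"
  let ?w = "\<lambda>\<rho> \<tau>. \<Prod>e\<in>E. exp (J e * ((\<Prod>x\<in>e. \<rho> x) * (\<Prod>x\<in>e. \<tau> x) + (\<Prod>x\<in>e. \<tau> x)))"
  have vV: "v i \<in> V" if "i \<in> T" for i using T that by auto
  have "(\<Sum>j\<in>T. ?s j * (\<Sum>\<sigma>\<in>?\<Omega>. \<Sum>\<tau>\<in>?\<Omega>. \<sigma> (v m) * \<sigma> (v j) * (\<tau> (v m) * \<tau> (v j) * (\<Prod>i\<in>T. \<tau> (v i))) *
      (ising_weight E J \<sigma> * ising_weight E J \<tau>))) =
    (\<Sum>\<sigma>\<in>?\<Omega>. \<Sum>\<tau>\<in>?\<Omega>. (\<sigma> (v m) * \<tau> (v m) * (\<Sum>j\<in>T. ?s j * (\<sigma> (v j) * \<tau> (v j)))) *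
      ((\<Prod>i\<in>T. \<tau> (v i)) * (ising_weight E J \<sigma> * ising_weight E J \<tau>)))"
    unfolding sum_distrib_left sum_distrib_right
    by (subst sum.swap, rule sum.cong[OF refl], subst sum.swap, intro sum.cong) (auto simp: algebra_simps)
  also have "\<dots> = (\<Sum>\<rho>\<in>?\<Omega>. \<Sum>\<tau>\<in>?\<Omega>. h \<rho> * ((\<Prod>i\<in>T. \<tau> (v i)) * ?w \<rho> \<tau>))"
  proof (subst sum_spin_ratio, intro sum.cong refl)
    fix \<rho> \<tau> assume \<rho>: "\<rho> \<in> ?\<Omega>" and \<tau>: "\<tau> \<in> ?\<Omega>"
    let ?\<sigma> = "\<lambda>x\<in>V. \<rho> x * \<tau> x"
    have \<sigma>\<tau>: "?\<sigma> x * \<tau> x = \<rho> x" if "x \<in> V" for x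
      using that by (simp add: mult.assoc spin_square[OF \<tau>])
    have "(\<Prod>x\<in>e. ?\<sigma> x) = (\<Prod>x\<in>e. \<rho> x) * (\<Prod>x\<in>e. \<tau> x)" if "e \<in> E" for e
    proof -
      have "e \<subseteq> V" using G that by (auto simp: finite_simple_graph_def)
      then show ?thesis unfolding prod.distrib[symmetric] by (intro prod.cong) auto
    qed
    then have "ising_weight E J ?\<sigma> * ising_weight E J \<tau> = ?w \<rho> \<tau>"
      unfolding ising_weight_def prod.distrib[symmetric]
      by (intro prod.cong) (auto simp: distrib_left exp_add)
    moreover have "?\<sigma> (v m) * \<tau> (v m) * (\<Sum>j\<in>T. ?s j * (?\<sigma> (v j) * \<tau> (v j))) = h \<rho>"
    proof -
      have "(\<Sum>j\<in>T. ?s j * (?\<sigma> (v j) * \<tau> (v j))) = (\<Sum>j\<in>T. ?s j * \<rho> (v j))"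
        by (rule sum.cong[OF refl]) (simp only: \<sigma>\<tau> vV)
      then show ?thesis unfolding h_def by (simp only: \<sigma>\<tau>[OF vV[OF m]])
    qed
    ultimately show "?\<sigma> (v m) * \<tau> (v m) * (\<Sum>j\<in>T. ?s j * (?\<sigma> (v j) * \<tau> (v j))) *
      ((\<Prod>i\<in>T. \<tau> (v i)) * (ising_weight E J ?\<sigma> * ising_weight E J \<tau>)) =
      h \<rho> * ((\<Prod>i\<in>T. \<tau> (v i)) * ?w \<rho> \<tau>)" by simp
  qed
  also have "\<dots> = 0"
  proof (rule sum.neutral, intro ballI)
    fix \<rho> assume \<rho>: "\<rho> \<in> ?\<Omega>"
    define H where "H = {e \<in> E. (\<Prod>x\<in>e. \<rho> x) = 1}"
    define cl where "cl = (\<lambda>i. (adj H)\<^sup>* `` {v i})"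
    have cl_iff: "cl i = cl j \<longleftrightarrow> v i \<in> cl j" for i j
      unfolding cl_def by (auto dest: adj_rtrancl_sym rtrancl_trans)
    \<comment> \<open>Either all clusters contain an even number of indices of \<open>T\<close>, and
      \<open>h \<rho>\<close> is 0, or some cluster contains an odd number, and flipping it kills
      the sum over \<tau>.\<close>
    show "(\<Sum>\<tau>\<in>?\<Omega>. h \<rho> * ((\<Prod>i\<in>T. \<tau> (v i)) * ?w \<rho> \<tau>)) = 0"
    proof (cases "\<forall>c. even (card {j \<in> T. cl j = c})")
      case True
      have "(\<Sum>j\<in>T. ?s j * \<rho> (v j)) = 0"
      proof (rule noncrossing_alternating_sum[OF T(1)])
        show "noncrossing T cl" unfolding cl_def by (rule nc) (simp add: H_def)
        show "\<rho> (v i) = \<rho> (v j)" if "cl i = cl j" for i j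
          using that cluster_spin_const[OF G \<rho> H_def] unfolding cl_iff by (simp add: cl_def)
      qed (use True in auto)
      then show ?thesis by (simp add: h_def)
    next
      case False
      then obtain c where c: "odd (card {j \<in> T. cl j = c})" by blast
      then have "{j \<in> T. cl j = c} \<noteq> {}" by (metis card.empty even_zero)
      then obtain i0 where i0: "cl i0 = c" by blast
      have "(\<Sum>\<tau>\<in>?\<Omega>. (\<Prod>i\<in>T. \<tau> (v i)) * ?w \<rho> \<tau>) = 0"
      proof (rule odd_cluster_sum_zero[OF G \<rho> T H_def])
        show "odd (card {i \<in> T. v i \<in> cl i0})" using c unfolding i0[symmetric] cl_iff .
      qed (simp add: cl_def)
      then show ?thesis by (simp add: sum_distrib_left[symmetric])
    qed
  qed
  finally show ?thesis .
qed

text \<open>In the alternating sum the term \<open>m\<close> is the full correlation, because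
  squares of spins are 1, and every other term factors into a two-point function and a shorter
  correlation. Solving for the term \<open>m\<close> gives the recursion.\<close>

lemma ising_corr_pfaffian_recursion:
  fixes v :: "nat \<Rightarrow> 'a"
  assumes G: "finite_simple_graph V E"
    and nc: "\<And>H. H \<subseteq> E \<Longrightarrow> noncrossing T (\<lambda>i. (adj H)\<^sup>* `` {v i})"
    and T: "finite T" "v ` T \<subseteq> V" "T \<noteq> {}"
  shows "ising_corr V E J v T = (\<Sum>j\<in>T - {Min T}. (-1) ^ card (T \<inter> {Min T<..<j}) *
    ising_pair V E J (v (Min T)) (v j) * ising_corr V E J v (T - {Min T, j}))"
proof -
  let ?\<Omega> = "spin_configs V"
  let ?Z = "ising_partition V E J"
  let ?w = "ising_weight E J"
  define m where "m = Min T"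
  have m: "m \<in> T" using T by (simp add: m_def)
  have lt: "m < j" if "j \<in> T" "j \<noteq> m" for j
    using Min_le[OF T(1) that(1)] that(2) by (simp add: m_def)
  have V: "finite V" using G by (simp add: finite_simple_graph_def)
  have Z: "?Z > 0" by (rule ising_partition_pos[OF V])
  let ?G = "\<lambda>j. \<Sum>\<sigma>\<in>?\<Omega>. \<Sum>\<tau>\<in>?\<Omega>. \<sigma> (v m) * \<sigma> (v j) * (\<tau> (v m) * \<tau> (v j) * (\<Prod>i\<in>T. \<tau> (v i))) *
      (?w \<sigma> * ?w \<tau>)"
  let ?s = "\<lambda>j. (-1 :: real) ^ card (T \<inter> {..<j})"
  let ?t = "\<lambda>j. (-1 :: real) ^ card (T \<inter> {m<..<j})"
  have vV: "v i \<in> V" if "i \<in> T" for i using T that by auto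
  have Gm: "?G m = ?Z * ?Z * ising_corr V E J v T"
  proof -
    have "?G m = (\<Sum>\<sigma>\<in>?\<Omega>. \<Sum>\<tau>\<in>?\<Omega>. ?w \<sigma> * ((\<Prod>i\<in>T. \<tau> (v i)) * ?w \<tau>))"
      by (intro sum.cong refl)
        (simp add: spin_square[OF _ vV[OF m]] spin_square_left[OF _ vV[OF m]])
    also have "\<dots> = ?Z * (\<Sum>\<tau>\<in>?\<Omega>. (\<Prod>i\<in>T. \<tau> (v i)) * ?w \<tau>)"
      by (simp add: ising_partition_def sum_product)
    finally show ?thesis using Z by (simp add: ising_corr_def)
  qed
  have Gj: "?G j = ?Z * ?Z * (ising_pair V E J (v m) (v j) * ising_corr V E J v (T - {m, j}))"
    if j: "j \<in> T - {m}" for j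
  proof -
    have jT: "j \<in> T" using j by simp
    have "\<tau> (v m) * \<tau> (v j) * (\<Prod>i\<in>T. \<tau> (v i)) = (\<Prod>i\<in>T - {m, j}. \<tau> (v i))"
      if \<tau>: "\<tau> \<in> ?\<Omega>" for \<tau>
    proof -
      have "(\<Prod>i\<in>T. \<tau> (v i)) = \<tau> (v m) * (\<tau> (v j) * (\<Prod>i\<in>T - {m} - {j}. \<tau> (v i)))"
        using T(1) m j by (simp add: prod.remove[of T m] prod.remove[of "T - {m}" j])
      moreover have "T - {m} - {j} = T - {m, j}" by auto
      moreover have "\<tau> (v m) * \<tau> (v j) * (\<tau> (v m) * (\<tau> (v j) * r)) =
          (\<tau> (v m) * \<tau> (v m)) * ((\<tau> (v j) * \<tau> (v j)) * r)" for r
        by (simp only: mult.assoc mult.left_commute)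
      ultimately show ?thesis
        by (simp only: spin_square[OF \<tau> vV[OF m]] spin_square[OF \<tau> vV[OF jT]] mult_1_left)
    qed
    then have "?G j = (\<Sum>\<sigma>\<in>?\<Omega>. \<Sum>\<tau>\<in>?\<Omega>. \<sigma> (v m) * \<sigma> (v j) * ?w \<sigma> * ((\<Prod>i\<in>T - {m, j}. \<tau> (v i)) * ?w \<tau>))"
      by (intro sum.cong refl) (simp add: algebra_simps)
    also have "\<dots> = (\<Sum>\<sigma>\<in>?\<Omega>. \<sigma> (v m) * \<sigma> (v j) * ?w \<sigma>) * (\<Sum>\<tau>\<in>?\<Omega>. (\<Prod>i\<in>T - {m, j}. \<tau> (v i)) * ?w \<tau>)"
      by (simp add: sum_product)
    finally show ?thesis using Z by (simp add: ising_corr_def ising_pair_def)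
  qed
  have sm: "?s m = 1"
  proof -
    have "T \<inter> {..<m} = {}" using lt by force
    then show ?thesis by simp
  qed
  \<comment> \<open>The first index \<open>m\<close> precedes \<open>j\<close> but is not strictly
    between \<open>m\<close> and \<open>j\<close>; this is the minus sign that disappears when the
    terms change sides.\<close>
  have sj: "?s j = - ?t j" if j: "j \<in> T - {m}" for j
  proof -
    have "T \<inter> {..<j} = insert m (T \<inter> {m<..<j})" using lt j m by auto
    then have "card (T \<inter> {..<j}) = Suc (card (T \<inter> {m<..<j}))" using T(1) by simp
    then show ?thesis by simp
  qed
  have "(\<Sum>j\<in>T. ?s j * ?G j) = 0"
    by (rule ising_alternating_sum[OF G nc T(1,2) m])
  then have "?s m * ?G m + (\<Sum>j\<in>T - {m}. ?s j * ?G j) = 0"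
    using sum.remove[OF T(1) m, of "\<lambda>j. ?s j * ?G j"] by simp
  moreover have "(\<Sum>j\<in>T - {m}. ?s j * ?G j) = - (?Z * ?Z *
     (\<Sum>j\<in>T - {m}. ?t j * ising_pair V E J (v m) (v j) * ising_corr V E J v (T - {m, j})))"
  proof -
    have "(\<Sum>j\<in>T - {m}. ?s j * ?G j) = (\<Sum>j\<in>T - {m}.
        - (?Z * ?Z * (?t j * ising_pair V E J (v m) (v j) * ising_corr V E J v (T - {m, j}))))"
    proof (rule sum.cong[OF refl])
      fix j assume j: "j \<in> T - {m}"
      show "?s j * ?G j = - (?Z * ?Z * (?t j * ising_pair V E J (v m) (v j) * ising_corr V E J v (T - {m, j})))"
        unfolding Gj[OF j] sj[OF j] by simp
    qed
    then show ?thesis by (simp only: sum_negf sum_distrib_left)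
  qed
  ultimately have "?Z * ?Z * ising_corr V E J v T = ?Z * ?Z *
     (\<Sum>j\<in>T - {m}. ?t j * ising_pair V E J (v m) (v j) * ising_corr V E J v (T - {m, j}))"
    unfolding Gm sm by simp
  then show ?thesis using Z unfolding m_def[symmetric] by simp
qed

lemma ising_corr_empty: "finite V \<Longrightarrow> ising_corr V E J v {} = 1"
  using ising_partition_pos[of V E J] by (simp add: ising_corr_def ising_partition_def)

lemma ising_pair_sym: "ising_pair V E J x y = ising_pair V E J y x"
  by (simp add: ising_pair_def mult.commute)

section \<open>Ginibre positivity\<close>

text \<open>All monomials are tested, so that the class is closed under multiplication by
  \<open>phi\<close> and \<open>phi_tilde\<close>.\<close>

definition ginibre_positive :: "'a set \<Rightarrow> (('a \<Rightarrow> real) \<Rightarrow> ('a \<Rightarrow> real) \<Rightarrow> real) \<Rightarrow> bool" where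
  "ginibre_positive V g \<longleftrightarrow> (\<forall>a b :: 'a \<Rightarrow> nat.
     0 \<le> (\<Sum>\<sigma>\<in>spin_configs V. \<Sum>\<tau>\<in>spin_configs V.
       (\<Prod>x\<in>V. phi \<sigma> \<tau> x ^ a x * phi_tilde \<sigma> \<tau> x ^ b x) * g \<sigma> \<tau>))"

lemma ginibre_positive_cong:
  assumes "ginibre_positive V g"
    and "\<And>\<sigma> \<tau>. \<sigma> \<in> spin_configs V \<Longrightarrow> \<tau> \<in> spin_configs V \<Longrightarrow> h \<sigma> \<tau> = g \<sigma> \<tau>"
  shows "ginibre_positive V h"
  using assms by (simp add: ginibre_positive_def)

lemma ginibre_positive_add:
  "ginibre_positive V g \<Longrightarrow> ginibre_positive V h \<Longrightarrow> ginibre_positive V (\<lambda>\<sigma> \<tau>. g \<sigma> \<tau> + h \<sigma> \<tau>)"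
  by (simp add: ginibre_positive_def distrib_left sum.distrib)

lemma ginibre_positive_scale:
  assumes "ginibre_positive V g" "0 \<le> c"
  shows "ginibre_positive V (\<lambda>\<sigma> \<tau>. c * g \<sigma> \<tau>)"
  unfolding ginibre_positive_def
proof (intro allI)
  fix a b :: "'a \<Rightarrow> nat"
  let ?p = "\<lambda>\<sigma> \<tau>. \<Prod>x\<in>V. phi \<sigma> \<tau> x ^ a x * phi_tilde \<sigma> \<tau> x ^ b x"
  have "0 \<le> c * (\<Sum>\<sigma>\<in>spin_configs V. \<Sum>\<tau>\<in>spin_configs V. ?p \<sigma> \<tau> * g \<sigma> \<tau>)"
    using assms by (simp add: ginibre_positive_def)
  also have "\<dots> = (\<Sum>\<sigma>\<in>spin_configs V. \<Sum>\<tau>\<in>spin_configs V. ?p \<sigma> \<tau> * (c * g \<sigma> \<tau>))"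
    unfolding sum_distrib_left by (intro sum.cong refl) simp
  finally show "0 \<le> (\<Sum>\<sigma>\<in>spin_configs V. \<Sum>\<tau>\<in>spin_configs V. ?p \<sigma> \<tau> * (c * g \<sigma> \<tau>))" .
qed

lemma prod_power_update:
  fixes f :: "'a \<Rightarrow> 'b::comm_semiring_1"
  assumes "finite V" "u \<in> V"
  shows "(\<Prod>x\<in>V. f x ^ (a(u := Suc (a u))) x) = f u * (\<Prod>x\<in>V. f x ^ a x)"
proof -
  have "(\<Prod>x\<in>V - {u}. f x ^ (a(u := Suc (a u))) x) = (\<Prod>x\<in>V - {u}. f x ^ a x)"
    by (rule prod.cong) auto
  then show ?thesis using assms by (simp add: prod.remove mult.assoc)
qed

lemma ginibre_positive_phi:
  assumes V: "finite V" "u \<in> V" and g: "ginibre_positive V g"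
  shows "ginibre_positive V (\<lambda>\<sigma> \<tau>. phi \<sigma> \<tau> u * g \<sigma> \<tau>)"
  unfolding ginibre_positive_def
proof (intro allI)
  fix a b :: "'a \<Rightarrow> nat"
  have "(\<Prod>x\<in>V. phi \<sigma> \<tau> x ^ a x * phi_tilde \<sigma> \<tau> x ^ b x) * (phi \<sigma> \<tau> u * g \<sigma> \<tau>) =
    (\<Prod>x\<in>V. phi \<sigma> \<tau> x ^ (a(u := Suc (a u))) x * phi_tilde \<sigma> \<tau> x ^ b x) * g \<sigma> \<tau>" for \<sigma> \<tau>
    unfolding prod.distrib prod_power_update[OF V] by (simp add: algebra_simps)
  then show "0 \<le> (\<Sum>\<sigma>\<in>spin_configs V. \<Sum>\<tau>\<in>spin_configs V.
      (\<Prod>x\<in>V. phi \<sigma> \<tau> x ^ a x * phi_tilde \<sigma> \<tau> x ^ b x) * (phi \<sigma> \<tau> u * g \<sigma> \<tau>))"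
    using g unfolding ginibre_positive_def by presburger
qed

lemma ginibre_positive_phi_tilde:
  assumes V: "finite V" "u \<in> V" and g: "ginibre_positive V g"
  shows "ginibre_positive V (\<lambda>\<sigma> \<tau>. phi_tilde \<sigma> \<tau> u * g \<sigma> \<tau>)"
  unfolding ginibre_positive_def
proof (intro allI)
  fix a b :: "'a \<Rightarrow> nat"
  have "(\<Prod>x\<in>V. phi \<sigma> \<tau> x ^ a x * phi_tilde \<sigma> \<tau> x ^ b x) * (phi_tilde \<sigma> \<tau> u * g \<sigma> \<tau>) =
    (\<Prod>x\<in>V. phi \<sigma> \<tau> x ^ a x * phi_tilde \<sigma> \<tau> x ^ (b(u := Suc (b u))) x) * g \<sigma> \<tau>" for \<sigma> \<tau>
    unfolding prod.distrib prod_power_update[OF V] by (simp add: algebra_simps)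
  then show "0 \<le> (\<Sum>\<sigma>\<in>spin_configs V. \<Sum>\<tau>\<in>spin_configs V.
      (\<Prod>x\<in>V. phi \<sigma> \<tau> x ^ a x * phi_tilde \<sigma> \<tau> x ^ b x) * (phi_tilde \<sigma> \<tau> u * g \<sigma> \<tau>))"
    using g unfolding ginibre_positive_def by presburger
qed

text \<open>The sum factors over the vertices. At each vertex exactly one of \<open>phi\<close> and
  \<open>phi_tilde\<close> vanishes and the other is 1 or -1 equally often, so the sum at one vertex
  is nonnegative.\<close>

lemma ginibre_positive_one:
  assumes V: "finite V"
  shows "ginibre_positive V (\<lambda>_ _. 1)"
  unfolding ginibre_positive_def
proof (intro allI)
  fix a b :: "'a \<Rightarrow> nat"
  let ?f = "\<lambda>x s t. ((s + t) / 2) ^ a x * ((s - t) / 2) ^ b x :: real"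
  have "(\<Sum>\<sigma>\<in>spin_configs V. \<Sum>\<tau>\<in>spin_configs V. \<Prod>x\<in>V. phi \<sigma> \<tau> x ^ a x * phi_tilde \<sigma> \<tau> x ^ b x) =
    (\<Sum>\<sigma>\<in>V \<rightarrow>\<^sub>E {-1, 1}. \<Sum>\<tau>\<in>V \<rightarrow>\<^sub>E {-1, 1}. \<Prod>x\<in>V. ?f x (\<sigma> x) (\<tau> x))"
    by (simp add: spin_configs_def phi_def phi_tilde_def)
  also have "\<dots> = (\<Sum>\<sigma>\<in>V \<rightarrow>\<^sub>E {-1, 1}. \<Prod>x\<in>V. \<Sum>t\<in>{-1, 1}. ?f x (\<sigma> x) t)"
    by (intro sum.cong refl prod_sum_PiE[symmetric]) (use V in auto)
  also have "\<dots> = (\<Prod>x\<in>V. \<Sum>s\<in>{-1, 1}. \<Sum>t\<in>{-1, 1}. ?f x s t)"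
    by (intro prod_sum_PiE[symmetric]) (use V in auto)
  also have "\<dots> \<ge> 0"
  proof (rule prod_nonneg)
    show "0 \<le> (\<Sum>s\<in>{-1, 1}. \<Sum>t\<in>{-1, 1}. ?f x s t)" for x
      using minus_one_power_iff[of "a x", where ?'a = real] minus_one_power_iff[of "b x", where ?'a = real]
      by (cases "a x"; cases "b x") (auto split: if_splits)
  qed
  finally show "0 \<le> (\<Sum>\<sigma>\<in>spin_configs V. \<Sum>\<tau>\<in>spin_configs V.
      (\<Prod>x\<in>V. phi \<sigma> \<tau> x ^ a x * phi_tilde \<sigma> \<tau> x ^ b x) * 1)" by simp
qed

text \<open>As \<open>\<phi>\<^sub>u\<phi>\<^sub>v + \<phi>'\<^sub>u\<phi>'\<^sub>v\<close> takes only the values \<open>-1, 0, 1\<close>, the edge weight is a quadratic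
  polynomial in it, with nonnegative coefficients if \<open>j \<ge> 0\<close>.\<close>

lemma edge_weight_phi:
  fixes j :: real
  assumes "\<sigma> u = 1 \<or> \<sigma> u = -1" "\<sigma> v = 1 \<or> \<sigma> v = -1" "\<tau> u = 1 \<or> \<tau> u = -1" "\<tau> v = 1 \<or> \<tau> v = -1"
    and z: "z = phi \<sigma> \<tau> u * phi \<sigma> \<tau> v + phi_tilde \<sigma> \<tau> u * phi_tilde \<sigma> \<tau> v"
  shows "exp (j * (\<sigma> u * \<sigma> v)) * exp (j * (\<tau> u * \<tau> v)) =
    1 + sinh (2 * j) * z + (cosh (2 * j) - 1) * (z * z)"
proof -
  have "exp j * exp j = exp (2 * j)" "exp (- j) * exp (- j) = exp (- (2 * j))"
    "exp j * exp (- j) = 1" "exp (- j) * exp j = 1"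
    by (simp_all flip: exp_add)
  moreover have "cosh (2 * j) + sinh (2 * j) = exp (2 * j)" "cosh (2 * j) - sinh (2 * j) = exp (- (2 * j))"
    by (rule cosh_plus_sinh cosh_minus_sinh)+
  ultimately show ?thesis
    using assms(1-4) unfolding z by (elim disjE) (simp_all add: phi_def phi_tilde_def)
qed

text \<open>The edges are added one at a time. Each multiplies the weight by a polynomial in the
  fields with the nonnegative coefficients \<open>1\<close>, \<open>sinh (2 * J e)\<close> and
  \<open>cosh (2 * J e) - 1\<close>.\<close>

lemma ginibre_positive_weight:
  assumes G: "finite_simple_graph V E" and J: "\<forall>e\<in>E. J e \<ge> 0"
  shows "ginibre_positive V (\<lambda>\<sigma> \<tau>. ising_weight E J \<sigma> * ising_weight E J \<tau>)"
proof -
  have V: "finite V" using G by (simp add: finite_simple_graph_def)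
  have "ginibre_positive V (\<lambda>\<sigma> \<tau>. ising_weight F J \<sigma> * ising_weight F J \<tau>)" if "finite F" "F \<subseteq> E" for F
    using that
  proof (induction rule: finite_induct)
    case empty
    then show ?case using ginibre_positive_one[OF V] by (simp add: ising_weight_def)
  next
    case (insert e F)
    let ?g = "\<lambda>\<sigma> \<tau>. ising_weight F J \<sigma> * ising_weight F J \<tau>"
    have g: "ginibre_positive V ?g" using insert by simp
    obtain u v where e: "e = {u, v}" "u \<noteq> v" "u \<in> V" "v \<in> V"
      using simple_graph_edgeE[OF G, of e] insert by auto
    have Je: "J e \<ge> 0" using J insert by simp
    define z where "z = (\<lambda>\<sigma> \<tau>. phi \<sigma> \<tau> u * phi \<sigma> \<tau> v + phi_tilde \<sigma> \<tau> u * phi_tilde \<sigma> \<tau> v)"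
    have zg: "ginibre_positive V (\<lambda>\<sigma> \<tau>. z \<sigma> \<tau> * h \<sigma> \<tau>)" if "ginibre_positive V h" for h
    proof -
      have "ginibre_positive V (\<lambda>\<sigma> \<tau>. phi \<sigma> \<tau> u * (phi \<sigma> \<tau> v * h \<sigma> \<tau>) +
          phi_tilde \<sigma> \<tau> u * (phi_tilde \<sigma> \<tau> v * h \<sigma> \<tau>))"
        using V e that by (intro ginibre_positive_add ginibre_positive_phi ginibre_positive_phi_tilde)
      then show ?thesis by (rule ginibre_positive_cong) (simp add: z_def algebra_simps)
    qed
    have "cosh (2 * J e) \<ge> 1" by (rule cosh_real_ge_1)
    moreover have "sinh (2 * J e) \<ge> 0" using Je by simp
    ultimately have "ginibre_positive V (\<lambda>\<sigma> \<tau>. ?g \<sigma> \<tau> + (sinh (2 * J e) * (z \<sigma> \<tau> * ?g \<sigma> \<tau>) +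
        (cosh (2 * J e) - 1) * (z \<sigma> \<tau> * (z \<sigma> \<tau> * ?g \<sigma> \<tau>))))"
      by (intro ginibre_positive_add ginibre_positive_scale zg g) auto
    then show ?case
    proof (rule ginibre_positive_cong)
      fix \<sigma> \<tau> assume "\<sigma> \<in> spin_configs V" "\<tau> \<in> spin_configs V"
      then have "exp (J e * (\<sigma> u * \<sigma> v)) * exp (J e * (\<tau> u * \<tau> v)) =
          1 + sinh (2 * J e) * z \<sigma> \<tau> + (cosh (2 * J e) - 1) * (z \<sigma> \<tau> * z \<sigma> \<tau>)"
        unfolding z_def using e by (intro edge_weight_phi) (auto dest: spin_cases)
      moreover have "ising_weight (insert e F) J \<sigma> * ising_weight (insert e F) J \<tau> =
          exp (J e * (\<sigma> u * \<sigma> v)) * exp (J e * (\<tau> u * \<tau> v)) * ?g \<sigma> \<tau>"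
        using insert.hyps e(2) unfolding ising_weight_def by (simp add: e(1) algebra_simps)
      ultimately show "ising_weight (insert e F) J \<sigma> * ising_weight (insert e F) J \<tau> =
          ?g \<sigma> \<tau> + (sinh (2 * J e) * (z \<sigma> \<tau> * ?g \<sigma> \<tau>) +
          (cosh (2 * J e) - 1) * (z \<sigma> \<tau> * (z \<sigma> \<tau> * ?g \<sigma> \<tau>)))"
        by (simp only:) (simp add: algebra_simps)
    qed
  qed
  then show ?thesis using finite_simple_graph_finite_edges[OF G] by simp
qed

lemma ginibre_positive_prod_phi:
  assumes V: "finite V" and g: "ginibre_positive V g" and A: "A \<subseteq> V"
  shows "ginibre_positive V (\<lambda>\<sigma> \<tau>. (\<Prod>x\<in>A. phi \<sigma> \<tau> x) * g \<sigma> \<tau>)"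
    and "ginibre_positive V (\<lambda>\<sigma> \<tau>. (\<Prod>x\<in>A. phi_tilde \<sigma> \<tau> x) * g \<sigma> \<tau>)"
proof -
  have "finite A" using A V finite_subset by blast
  then show "ginibre_positive V (\<lambda>\<sigma> \<tau>. (\<Prod>x\<in>A. phi \<sigma> \<tau> x) * g \<sigma> \<tau>)" using A
  proof (induction rule: finite_induct)
    case (insert u A)
    then show ?case using ginibre_positive_phi[OF V, of u "\<lambda>\<sigma> \<tau>. (\<Prod>x\<in>A. phi \<sigma> \<tau> x) * g \<sigma> \<tau>"]
      by (simp add: mult.assoc)
  qed (use g in simp)
  from \<open>finite A\<close> show "ginibre_positive V (\<lambda>\<sigma> \<tau>. (\<Prod>x\<in>A. phi_tilde \<sigma> \<tau> x) * g \<sigma> \<tau>)" using A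
  proof (induction rule: finite_induct)
    case (insert u A)
    then show ?case using ginibre_positive_phi_tilde[OF V, of u "\<lambda>\<sigma> \<tau>. (\<Prod>x\<in>A. phi_tilde \<sigma> \<tau> x) * g \<sigma> \<tau>"]
      by (simp add: mult.assoc)
  qed (use g in simp)
qed

lemma AT_expect_phi_nonneg:
  assumes G: "finite_simple_graph V E" and U0: "\<forall>e\<in>E. U e = 0" and J: "\<forall>e\<in>E. J e \<ge> 0"
    and sub: "A1 \<subseteq> V" "A2 \<subseteq> V" "B1 \<subseteq> V" "B2 \<subseteq> V"
  shows "0 \<le> AT_expect V E J U (\<lambda>\<sigma> \<tau>.
    (\<Prod>v\<in>A1. phi \<sigma> \<tau> v) * (\<Prod>v\<in>A2. (phi \<sigma> \<tau> v)\<^sup>2) *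
    (\<Prod>v\<in>B1. phi_tilde \<sigma> \<tau> v) * (\<Prod>v\<in>B2. (phi_tilde \<sigma> \<tau> v)\<^sup>2))"
proof -
  have V: "finite V" using G by (simp add: finite_simple_graph_def)
  let ?w = "\<lambda>\<sigma> \<tau>. ising_weight E J \<sigma> * ising_weight E J \<tau>"
  have "ginibre_positive V (\<lambda>\<sigma> \<tau>. (\<Prod>v\<in>A1. phi \<sigma> \<tau> v) * ((\<Prod>v\<in>A2. phi \<sigma> \<tau> v) * ((\<Prod>v\<in>A2. phi \<sigma> \<tau> v) *
    ((\<Prod>v\<in>B1. phi_tilde \<sigma> \<tau> v) * ((\<Prod>v\<in>B2. phi_tilde \<sigma> \<tau> v) * ((\<Prod>v\<in>B2. phi_tilde \<sigma> \<tau> v) * ?w \<sigma> \<tau>))))))"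
    by (intro ginibre_positive_prod_phi ginibre_positive_weight G J V sub)
  then have "ginibre_positive V (\<lambda>\<sigma> \<tau>. (\<Prod>v\<in>A1. phi \<sigma> \<tau> v) * (\<Prod>v\<in>A2. (phi \<sigma> \<tau> v)\<^sup>2) *
    (\<Prod>v\<in>B1. phi_tilde \<sigma> \<tau> v) * (\<Prod>v\<in>B2. (phi_tilde \<sigma> \<tau> v)\<^sup>2) * ?w \<sigma> \<tau>)"
    by (rule ginibre_positive_cong) (simp add: power2_eq_square prod.distrib mult.assoc)
  \<comment> \<open>The observable has already been absorbed into the weight, so the constant
    monomial suffices.\<close>
  from this[unfolded ginibre_positive_def, rule_format, of "\<lambda>_. 0" "\<lambda>_. 0"]
  show ?thesis
    unfolding AT_expect_ising[OF V U0] by (intro divide_nonneg_nonneg) auto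
qed

section \<open>The determinant formula\<close>

lemma cluster_eq_iff: "(adj H)\<^sup>* `` {x} = (adj H)\<^sup>* `` {y} \<longleftrightarrow> (x, y) \<in> (adj H)\<^sup>*"
  by (auto dest: adj_rtrancl_sym rtrancl_trans)

lemma nodes_noncrossing_clusters:
  assumes G: "finite_simple_graph V E" and pe: "plane_embedding V E pos \<gamma>"
    and ord: "ccw_outer_order (drawing V E pos \<gamma>) (map pos ws)" and wsV: "set ws \<subseteq> V"
    and ns: "ns = node_list D ws" and H: "H \<subseteq> E"
  shows "noncrossing {1..length ns} (\<lambda>k. (adj H)\<^sup>* `` {vertex (nth_node ns k)})"
  unfolding noncrossing_def cluster_eq_iff
proof (intro ballI impI)
  fix i j k l assume *: "i \<in> {1..length ns}" "l \<in> {1..length ns}" "i < j" "j < k" "k < l"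
    "(vertex (nth_node ns i), vertex (nth_node ns k)) \<in> (adj H)\<^sup>*"
    "(vertex (nth_node ns j), vertex (nth_node ns l)) \<in> (adj H)\<^sup>*"
  show "(vertex (nth_node ns i), vertex (nth_node ns j)) \<in> (adj H)\<^sup>*"
    unfolding nth_node_def ns
    \<comment> \<open>Nodes are numbered from 1, list positions from 0.\<close>
    by (rule outer_nodes_noncrossing[OF G pe ord wsV H refl, of "i - 1" "j - 1" "k - 1" "l - 1"])
      (use * in \<open>auto simp: nth_node_def ns\<close>)
qed

lemma prod_nth_node:
  assumes "distinct ns"
  shows "(\<Prod>k\<in>{1..length ns}. g (nth_node ns k)) = (\<Prod>n\<in>set ns. g n)"
proof -
  have "(\<Prod>k\<in>{1..length ns}. g (nth_node ns k)) = (\<Prod>k<length ns. g (ns ! k))"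
    by (simp add: prod.atLeast1_atMost_eq nth_node_def)
  also have "\<dots> = (\<Prod>n\<in>set ns. g n)"
    by (rule prod.reindex_bij_betw[OF bij_betw_nth[OF assms]]) auto
  finally show ?thesis .
qed

lemma prod_node_set:
  assumes "finite A" "finite D"
  shows "(\<Prod>n\<in>node_set A D. g (vertex n)) = (\<Prod>x\<in>A. g x) * (\<Prod>x\<in>D. (g x)\<^sup>2)"
proof -
  have "(\<Prod>n\<in>node_set A D. g (vertex n)) =
    (\<Prod>n\<in>Single ` A. g (vertex n)) * (\<Prod>n\<in>Lower ` D. g (vertex n)) * (\<Prod>n\<in>Upper ` D. g (vertex n))"
    unfolding node_set_def using assms by (subst prod.union_disjoint, auto)+
  also have "\<dots> = (\<Prod>x\<in>A. g x) * (\<Prod>x\<in>D. g x) * (\<Prod>x\<in>D. g x)"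
    by (simp add: prod.reindex inj_on_def)
  finally show ?thesis by (simp add: power2_eq_square prod.distrib mult.assoc)
qed

lemma K_det_eq_K_matrix:
  "K_det (\<lambda>k l. c (vertex (nth_node ns k)) (vertex (nth_node ns l))) P M = Determinant.det (K_matrix c ns P M)"
  by (simp add: K_det_def indexed_det_def K_matrix_def Let_def)

text \<open>A red node contributes half of \<sigma> + \<tau> and a blue node half of \<sigma> -
  \<tau>. In the expansion over the nodes, \<open>T\<close> is the set where \<sigma> is chosen, and
  independence of the replicas turns each term into a product of two Ising correlations.\<close>

lemma AT_expect_phi_two_replica_sum:
  assumes V: "finite V" and U0: "\<forall>e\<in>E. U e = 0"
    and fin: "finite A1" "finite A2" "finite B1" "finite B2"
    and disj: "(A1 \<union> A2) \<inter> (B1 \<union> B2) = {}"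
    and ns: "distinct ns" "set ns = node_set A1 A2 \<union> node_set B1 B2"
    and N: "N = {1..length ns}"
    and Q: "Q = (\<lambda>k. odd k \<and> nth_node ns k \<in> node_set B1 B2 \<or> even k \<and> nth_node ns k \<in> node_set A1 A2)"
  shows "AT_expect V E J U (\<lambda>\<sigma> \<tau>.
      (\<Prod>v\<in>A1. phi \<sigma> \<tau> v) * (\<Prod>v\<in>A2. (phi \<sigma> \<tau> v)\<^sup>2) *
      (\<Prod>v\<in>B1. phi_tilde \<sigma> \<tau> v) * (\<Prod>v\<in>B2. (phi_tilde \<sigma> \<tau> v)\<^sup>2)) =
    two_replica_sum (\<lambda>k. if Q k then -1 else 1)
      (ising_corr V E J (\<lambda>k. vertex (nth_node ns k))) N / 2 ^ card N"
proof -
  let ?R = "node_set A1 A2" and ?B = "node_set B1 B2"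
  let ?\<Omega> = "spin_configs V"
  let ?Z = "ising_partition V E J"
  let ?w = "ising_weight E J"
  define v where "v = (\<lambda>k. vertex (nth_node ns k))"
  define \<epsilon> where "\<epsilon> = (\<lambda>k. if nth_node ns k \<in> ?B then -1 else 1 :: real)"
  define d where "d = (\<lambda>k. if Q k then -1 else 1 :: real)"
  have RB: "?R \<inter> ?B = {}" using disj by (auto simp: node_set_def)
  have finN: "finite ?R" "finite ?B" using fin by (auto simp: node_set_def)
  have obs: "(\<Prod>x\<in>A1. phi \<sigma> \<tau> x) * (\<Prod>x\<in>A2. (phi \<sigma> \<tau> x)\<^sup>2) *
      (\<Prod>x\<in>B1. phi_tilde \<sigma> \<tau> x) * (\<Prod>x\<in>B2. (phi_tilde \<sigma> \<tau> x)\<^sup>2) =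
    (\<Sum>T\<in>Pow N. prod \<epsilon> (N - T) * ((\<Prod>k\<in>T. \<sigma> (v k)) * (\<Prod>k\<in>N - T. \<tau> (v k)))) / 2 ^ card N" for \<sigma> \<tau>
  proof -
    let ?g = "\<lambda>n. (\<sigma> (vertex n) + (if n \<in> ?B then -1 else 1) * \<tau> (vertex n)) / 2"
    have "(\<Prod>x\<in>A1. phi \<sigma> \<tau> x) * (\<Prod>x\<in>A2. (phi \<sigma> \<tau> x)\<^sup>2) *
        ((\<Prod>x\<in>B1. phi_tilde \<sigma> \<tau> x) * (\<Prod>x\<in>B2. (phi_tilde \<sigma> \<tau> x)\<^sup>2)) =
      (\<Prod>n\<in>?R. phi \<sigma> \<tau> (vertex n)) * (\<Prod>n\<in>?B. phi_tilde \<sigma> \<tau> (vertex n))"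
      using fin by (simp add: prod_node_set)
    also have "(\<Prod>n\<in>?R. phi \<sigma> \<tau> (vertex n)) = (\<Prod>n\<in>?R. ?g n)"
      using RB by (intro prod.cong) (auto simp: phi_def)
    also have "(\<Prod>n\<in>?B. phi_tilde \<sigma> \<tau> (vertex n)) = (\<Prod>n\<in>?B. ?g n)"
      by (intro prod.cong) (auto simp: phi_tilde_def)
    also have "(\<Prod>n\<in>?R. ?g n) * (\<Prod>n\<in>?B. ?g n) = (\<Prod>n\<in>set ns. ?g n)"
      unfolding ns(2) by (rule prod.union_disjoint[OF finN RB, symmetric])
    also have "\<dots> = (\<Prod>k\<in>N. ?g (nth_node ns k))"
      unfolding N by (rule prod_nth_node[OF ns(1), symmetric])
    also have "\<dots> = (\<Prod>k\<in>N. \<sigma> (v k) + \<epsilon> k * \<tau> (v k)) / 2 ^ card N"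
      by (simp add: prod_dividef v_def \<epsilon>_def)
    also have "(\<Prod>k\<in>N. \<sigma> (v k) + \<epsilon> k * \<tau> (v k)) =
      (\<Sum>T\<in>Pow N. (\<Prod>k\<in>T. \<sigma> (v k)) * (\<Prod>k\<in>N - T. \<epsilon> k * \<tau> (v k)))"
      by (rule prod_add) (simp add: N)
    also have "\<dots> = (\<Sum>T\<in>Pow N. prod \<epsilon> (N - T) * ((\<Prod>k\<in>T. \<sigma> (v k)) * (\<Prod>k\<in>N - T. \<tau> (v k))))"
      by (simp add: prod.distrib algebra_simps)
    finally show ?thesis by (simp add: mult.assoc)
  qed
  \<comment> \<open>Node \<open>k\<close> has \<open>k - 1\<close> predecessors, so the alternating
    sign is \<open>1\<close> at odd indices. To give \<open>-1\<close> for blue and \<open>1\<close>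
    for red nodes, \<open>d\<close> must be \<open>-1\<close> at odd blue and even red nodes, which
    are the sources.\<close>
  have sign: "d k * (-1) ^ card (N \<inter> {..<k}) = \<epsilon> k" if k: "k \<in> N" for k
  proof -
    have "N \<inter> {..<k} = {1..<k}" using k by (auto simp: N)
    then have c: "card (N \<inter> {..<k}) = k - 1" by simp
    have "nth_node ns k \<in> set ns" using k by (auto simp: nth_node_def N)
    then have "nth_node ns k \<in> ?R \<longleftrightarrow> nth_node ns k \<notin> ?B" using RB ns(2) by auto
    moreover have "even (k - 1) \<longleftrightarrow> odd k" using k by (cases k) (auto simp: N)
    ultimately show ?thesis
      unfolding c d_def Q \<epsilon>_def by (auto simp: minus_one_power_iff)
  qed
  have "AT_expect V E J U (\<lambda>\<sigma> \<tau>.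
      (\<Prod>v\<in>A1. phi \<sigma> \<tau> v) * (\<Prod>v\<in>A2. (phi \<sigma> \<tau> v)\<^sup>2) *
      (\<Prod>v\<in>B1. phi_tilde \<sigma> \<tau> v) * (\<Prod>v\<in>B2. (phi_tilde \<sigma> \<tau> v)\<^sup>2)) =
    (\<Sum>\<sigma>\<in>?\<Omega>. \<Sum>\<tau>\<in>?\<Omega>. \<Sum>T\<in>Pow N. prod \<epsilon> (N - T) *
      (((\<Prod>k\<in>T. \<sigma> (v k)) * ?w \<sigma>) * ((\<Prod>k\<in>N - T. \<tau> (v k)) * ?w \<tau>))) / (?Z * ?Z) / 2 ^ card N"
    unfolding AT_expect_ising[OF V U0] obs
    by (simp add: sum_divide_distrib sum_distrib_left sum_distrib_right algebra_simps)
  also have "(\<Sum>\<sigma>\<in>?\<Omega>. \<Sum>\<tau>\<in>?\<Omega>. \<Sum>T\<in>Pow N. prod \<epsilon> (N - T) *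
      (((\<Prod>k\<in>T. \<sigma> (v k)) * ?w \<sigma>) * ((\<Prod>k\<in>N - T. \<tau> (v k)) * ?w \<tau>))) =
    (\<Sum>T\<in>Pow N. \<Sum>\<sigma>\<in>?\<Omega>. \<Sum>\<tau>\<in>?\<Omega>. prod \<epsilon> (N - T) *
      (((\<Prod>k\<in>T. \<sigma> (v k)) * ?w \<sigma>) * ((\<Prod>k\<in>N - T. \<tau> (v k)) * ?w \<tau>)))"
    by (subst sum.swap[of _ "Pow N"], subst sum.swap[of _ "Pow N"]) (rule refl)
  also have "\<dots> / (?Z * ?Z) = (\<Sum>T\<in>Pow N. prod \<epsilon> (N - T) * (ising_corr V E J v T * ising_corr V E J v (N - T)))"
    unfolding sum_divide_distrib[of _ "Pow N"]
  proof (rule sum.cong[OF refl])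
    fix T
    have "(\<Sum>\<sigma>\<in>?\<Omega>. \<Sum>\<tau>\<in>?\<Omega>. prod \<epsilon> (N - T) *
        (((\<Prod>k\<in>T. \<sigma> (v k)) * ?w \<sigma>) * ((\<Prod>k\<in>N - T. \<tau> (v k)) * ?w \<tau>))) =
      prod \<epsilon> (N - T) * ((\<Sum>\<sigma>\<in>?\<Omega>. (\<Prod>k\<in>T. \<sigma> (v k)) * ?w \<sigma>) * (\<Sum>\<tau>\<in>?\<Omega>. (\<Prod>k\<in>N - T. \<tau> (v k)) * ?w \<tau>))"
      unfolding sum_product by (simp add: sum_distrib_left)
    then show "(\<Sum>\<sigma>\<in>?\<Omega>. \<Sum>\<tau>\<in>?\<Omega>. prod \<epsilon> (N - T) *
        (((\<Prod>k\<in>T. \<sigma> (v k)) * ?w \<sigma>) * ((\<Prod>k\<in>N - T. \<tau> (v k)) * ?w \<tau>))) / (?Z * ?Z) =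
      prod \<epsilon> (N - T) * (ising_corr V E J v T * ising_corr V E J v (N - T))"
      by (simp add: ising_corr_def)
  qed
  also have "\<dots> = two_replica_sum d (ising_corr V E J v) N"
    unfolding two_replica_sum_def
  proof (rule sum.cong[OF refl])
    fix T
    have "(\<Prod>i\<in>N - T. d i * (-1) ^ card (N \<inter> {..<i})) = prod \<epsilon> (N - T)"
      by (rule prod.cong[OF refl]) (simp add: sign)
    then show "prod \<epsilon> (N - T) * (ising_corr V E J v T * ising_corr V E J v (N - T)) =
      (\<Prod>i\<in>N - T. d i * (-1) ^ card (N \<inter> {..<i})) * ising_corr V E J v T * ising_corr V E J v (N - T)"
      by simp
  qed
  finally show ?thesis by (simp add: d_def v_def)
qed

theorem theorem11:
  fixes V :: "'a set" and E :: "'a set set"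
    and pos :: "'a \<Rightarrow> complex" and \<gamma> :: "'a set \<Rightarrow> real \<Rightarrow> complex"
    and J U :: "'a set \<Rightarrow> real"
    and A1 A2 B1 B2 :: "'a set" and ws :: "'a list"
    and ns :: "'a node list" and Red Blue :: "'a node set"
    and Splus Sminus :: "nat set" and K :: "real mat"
  assumes graph: "finite_simple_graph V E" "connected_graph V E"
    and embedding: "plane_embedding V E pos \<gamma>"
    and U0: "\<forall>e\<in>E. U e = 0"
    and in_V: "A1 \<union> A2 \<union> B1 \<union> B2 \<subseteq> V"
    and disj: "A1 \<inter> A2 = {}" "A1 \<inter> B1 = {}" "A1 \<inter> B2 = {}"
      "A2 \<inter> B1 = {}" "A2 \<inter> B2 = {}" "B1 \<inter> B2 = {}"
    and outer: "\<forall>v \<in> A1 \<union> A2 \<union> B1 \<union> B2. on_outer_face (drawing V E pos \<gamma>) (pos v)"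
    and ws: "distinct ws" "set ws = A1 \<union> A2 \<union> B1 \<union> B2"
    and ws_order: "ccw_outer_order (drawing V E pos \<gamma>) (map pos ws)"
    and ns: "ns = node_list (A2 \<union> B2) ws"
    and even_nodes: "even (card (node_set (A1 \<union> B1) (A2 \<union> B2)))"
    and Red: "Red = node_set A1 A2"
    and Blue: "Blue = node_set B1 B2"
    and Splus: "Splus = sources Red Blue ns"
    and Sminus: "Sminus = sinks Red Blue ns"
    and K: "K = K_matrix (\<lambda>u v. AT_expect V E J U (\<lambda>\<sigma> \<tau>. \<sigma> u * \<sigma> v)) ns Splus Sminus"
  shows "AT_expect V E J U (\<lambda>\<sigma> \<tau>.
            (\<Prod>v\<in>A1. phi \<sigma> \<tau> v) * (\<Prod>v\<in>A2. (phi \<sigma> \<tau> v)\<^sup>2) *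
            (\<Prod>v\<in>B1. phi_tilde \<sigma> \<tau> v) * (\<Prod>v\<in>B2. (phi_tilde \<sigma> \<tau> v)\<^sup>2))
         = (if card Splus = card Sminus
            then 2 powr (- real (card (node_set (A1 \<union> B1) (A2 \<union> B2))) / 2) * Determinant.det K
            else 0)
       \<and> (card Splus = card Sminus \<longrightarrow>
            (\<forall>e\<in>E. J e \<ge> 0 \<and> cosh (2 * J e) \<ge> exp (- 2 * U e)) \<longrightarrow>
            Determinant.det K \<ge> 0)"
proof -
  let ?corr = "\<lambda>u v. AT_expect V E J U (\<lambda>\<sigma> \<tau>. \<sigma> u * \<sigma> v)"
  define v where "v = (\<lambda>k. vertex (nth_node ns k))"
  define N where "N = {1..length ns}"
  define Q where "Q = (\<lambda>k. odd k \<and> nth_node ns k \<in> Blue \<or> even k \<and> nth_node ns k \<in> Red)"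
  let ?X = "AT_expect V E J U (\<lambda>\<sigma> \<tau>.
      (\<Prod>v\<in>A1. phi \<sigma> \<tau> v) * (\<Prod>v\<in>A2. (phi \<sigma> \<tau> v)\<^sup>2) *
      (\<Prod>v\<in>B1. phi_tilde \<sigma> \<tau> v) * (\<Prod>v\<in>B2. (phi_tilde \<sigma> \<tau> v)\<^sup>2))"
  have V: "finite V" using graph by (simp add: finite_simple_graph_def)
  have wsV: "set ws \<subseteq> V" using ws in_V by simp
  have fin: "finite A1" "finite A2" "finite B1" "finite B2"
    using in_V V by (auto intro: finite_subset)
  have dns: "distinct ns" using ns ws by (simp add: distinct_node_list)
  have set_ns: "set ns = node_set (A1 \<union> B1) (A2 \<union> B2)"
    unfolding ns using ws disj by (intro set_node_list) auto
  have RB: "set ns = Red \<union> Blue"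
    unfolding set_ns Red Blue by (auto simp: node_set_def)
  have RB_disj: "Red \<inter> Blue = {}"
    unfolding Red Blue using disj by (auto simp: node_set_def)
  have cardN: "card N = card (node_set (A1 \<union> B1) (A2 \<union> B2))"
    using distinct_card[OF dns] by (simp add: N_def set_ns)
  have vV: "v ` N \<subseteq> V"
  proof -
    have "vertex ` set ns \<subseteq> V" using in_V by (auto simp: set_ns node_set_def)
    moreover have "ns ! (k - 1) \<in> set ns" if "k \<in> N" for k using that by (auto simp: N_def)
    ultimately show ?thesis by (auto simp: v_def nth_node_def)
  qed
  have nc: "noncrossing T (\<lambda>k. (adj H)\<^sup>* `` {v k})" if "T \<subseteq> N" "H \<subseteq> E" for T H
    using noncrossing_subset[OF nodes_noncrossing_clusters[OF graph(1) embedding ws_order wsV ns that(2)]] that(1)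
    by (simp add: v_def N_def)
  \<comment> \<open>The observable depends on the first replica only, so the second one integrates
    to 1.\<close>
  have corr: "?corr x y = ising_pair V E J x y" for x y
    using AT_expect_ising_product[OF V U0, of J "\<lambda>\<sigma>. \<sigma> x * \<sigma> y" "\<lambda>_. 1"] ising_partition_pos[OF V, of E J]
    by (simp add: ising_pair_def ising_partition_def)
  have Sp: "Splus = {k \<in> N. Q k}"
    unfolding Splus sources_def N_def Q_def by auto
  \<comment> \<open>Every node has exactly one color, so the sinks are the complement of the
    sources.\<close>
  have Sm: "Sminus = {k \<in> N. \<not> Q k}"
  proof -
    have "nth_node ns k \<in> Red \<longleftrightarrow> nth_node ns k \<notin> Blue" if "k \<in> N" for k
    proof -
      have "nth_node ns k \<in> set ns" using that by (auto simp: nth_node_def N_def)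
      then show ?thesis using RB RB_disj by blast
    qed
    then show ?thesis unfolding Sminus sinks_def Q_def N_def by auto
  qed
  have expand: "?X = two_replica_sum (\<lambda>k. if Q k then -1 else 1) (ising_corr V E J v) N / 2 ^ card N"
    unfolding v_def
    by (rule AT_expect_phi_two_replica_sum[OF V U0 fin _ dns _ N_def])
      (use disj RB in \<open>auto simp: Q_def Red Blue\<close>)
  have "two_replica_sum (\<lambda>k. if Q k then -1 else 1) (ising_corr V E J v) N =
    (if card Splus = card Sminus
     then 2 ^ card Splus * K_det (\<lambda>k l. ising_pair V E J (v k) (v l)) Splus Sminus else 0)"
    unfolding Sp Sm
  proof (rule two_replica_sum_eq_det)
    show "finite N" by (simp add: N_def)
    show "ising_corr V E J v {} = 1" by (rule ising_corr_empty[OF V])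
    fix T assume T: "T \<subseteq> N" "T \<noteq> {}"
    then show "ising_corr V E J v T = (\<Sum>j\<in>T - {Min T}. (-1) ^ card (T \<inter> {Min T<..<j}) *
        ising_pair V E J (v (Min T)) (v j) * ising_corr V E J v (T - {Min T, j}))"
      using vV by (intro ising_corr_pfaffian_recursion[OF graph(1) nc])
        (auto simp: N_def intro: finite_subset)
  qed (rule ising_pair_sym)
  also have "K_det (\<lambda>k l. ising_pair V E J (v k) (v l)) Splus Sminus = Determinant.det K"
    unfolding K corr v_def K_det_eq_K_matrix ..
  finally have X: "?X = (if card Splus = card Sminus then 2 ^ card Splus * Determinant.det K else 0) / 2 ^ card N"
    unfolding expand by simp
  \<comment> \<open>In the balanced case the sources are half of the nodes; the determinant supplies
    one factor 2 per source against one factor 1/2 per node.\<close>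
  have half: "2 ^ card Splus / 2 ^ card N = (2 :: real) powr (- real (card N) / 2)"
    if "card Splus = card Sminus"
  proof -
    have "N = Splus \<union> Sminus" "Splus \<inter> Sminus = {}" "finite N"
      by (auto simp: Sp Sm N_def)
    then have "card N = 2 * card Splus" using that by (simp add: card_Un_disjoint)
    then show ?thesis
      by (simp only: mult_2 power_add) (simp add: powr_minus powr_realpow inverse_eq_divide)
  qed
  have main: "?X = (if card Splus = card Sminus
      then 2 powr (- real (card (node_set (A1 \<union> B1) (A2 \<union> B2))) / 2) * Determinant.det K else 0)"
  proof (cases "card Splus = card Sminus")
    case True
    then have "?X = 2 ^ card Splus / 2 ^ card N * Determinant.det K" unfolding X by simp
    then show ?thesis unfolding half[OF True] cardN[symmetric] using True by simp
  qed (simp add: X)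
  moreover have "Determinant.det K \<ge> 0"
    if "card Splus = card Sminus" "\<forall>e\<in>E. J e \<ge> 0 \<and> cosh (2 * J e) \<ge> exp (- 2 * U e)"
  proof -
    \<comment> \<open>The expectation is nonnegative by Ginibre positivity and is a positive
      multiple of the determinant.\<close>
    have "0 \<le> ?X"
      using AT_expect_phi_nonneg[OF graph(1) U0, of J A1 A2 B1 B2] that(2) in_V by auto
    then show ?thesis using that(1) unfolding main by (simp add: zero_le_mult_iff)
  qed
  ultimately show ?thesis by blast
qed

end
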